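(* Let $R$ be a commutative Noetherian ring of finite Krull dimension and let $M$ be a finitely generated $R$-module. Then $M$ is univalent (that is, $\operatorname{len}(M)=\omega^d$ for some $d\in\mathbb N$) if and only if the annihilator of $M$ is a prime ideal $\mathfrak p$ of $R$ and $M$ is isomorphic, as an $R$-module, to an ideal of $R/\mathfrak p$.
   Context: Ordinals are below $\omega^\omega$. The (ordinal) length $\operatorname{len}(M)$ of a finitely generated module $M$ over $R$ is the supremum of the order types of chains of nonzero submodules of $M$, where submodules are ordered by reverse inclusion (a well-order on each chain, by Noetherianity); it agrees with the usual length for modules of finite length. Equivalently, by a known theorem, $\operatorname{len}(M)=\bigoplus_{\mathfrak p\in\operatorname{Ass}(M)}\operatorname{finlen}(M_{\mathfrak p})\,\omega^{\dim(R/\mathfrak p)}$, where $\bigoplus$ is the natural (Hessenberg) sum of ordinals and $\operatorname{finlen}(M_{\mathfrak p})$ is the length of the largest $R_{\mathfrak p}$-submodule of finite length of $M_{\mathfrak p}$; this formula may be taken as the definition. *)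

theory Defs
  imports "HOL-Algebra.Algebra"
begin

section \<open>Suprema of order types, and the ordinals \<open>\<omega>\<^sup>d\<close>\<close>

text \<open>Ordinals are represented, up to \<open>=o\<close>, by well-order relations in the sense of
  \<^const>\<open>Well_order\<close> (reflexive on their field) and compared by \<open>\<le>o\<close>.

  In \<open>is_osup S r\<close> the competing upper bounds \<open>t\<close> live on the same type as \<open>r\<close>. Nothing is lost:
  an upper bound on any other type that is strictly below \<open>r\<close> would be isomorphic to a proper
  initial segment of \<open>r\<close>; see \<open>is_osup_least\<close> and \<open>is_osup_unique\<close> below.\<close>

definition is_osup :: "'c rel set \<Rightarrow> 'b rel \<Rightarrow> bool" where
  "is_osup S r \<longleftrightarrow>
     Well_order r \<and> (\<forall>s\<in>S. s \<le>o r) \<and>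
     (\<forall>t :: 'b rel. Well_order t \<and> (\<forall>s\<in>S. s \<le>o t) \<longrightarrow> r \<le>o t)"

lemma is_osup_least:
  fixes r :: "'b rel" and t :: "'d rel"
  assumes r: "is_osup S r" and t: "Well_order t" and ub: "\<And>s. s \<in> S \<Longrightarrow> s \<le>o t"
  shows "r \<le>o t"
proof (rule ccontr)
  assume "\<not> r \<le>o t"
  with r t have "t <o r"
    using not_ordLeq_iff_ordLess unfolding is_osup_def by blast
  then obtain a where a: "t =o Restr r (underS r a)"
    using internalize_ordLess[of t r] r t
    by (metis is_osup_def ordLess_iff_ordIso_Restr)
  let ?u = "Restr r (underS r a)"
  have "Well_order ?u"
    using r Well_order_Restr unfolding is_osup_def by blast
  moreover have "\<forall>s\<in>S. s \<le>o ?u"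
    using ub a ordLeq_ordIso_trans by blast
  ultimately have "r \<le>o ?u"
    using r unfolding is_osup_def by blast
  then have "r \<le>o t"
    using a ordIso_symmetric ordLeq_ordIso_trans by blast
  with \<open>\<not> r \<le>o t\<close> show False ..
qed

lemma is_osup_unique:
  assumes "is_osup S r" and "is_osup S t"
  shows "r =o t"
  using assms is_osup_least[of S r t] is_osup_least[of S t r]
  unfolding is_osup_def ordIso_iff_ordLeq by blast

text \<open>The ordinal \<open>\<omega>\<^sup>d\<close>: all \<open>d\<close>-tuples of natural numbers, ordered lexicographically with the
  most significant entry first (thus a single point for \<open>d = 0\<close>).\<close>

definition omega_pow :: "nat \<Rightarrow> nat list rel" where
  "omega_pow d = Id_on {xs. length xs = d} \<union> lexn less_than d"

lemma Field_omega_pow: "Field (omega_pow d) = {xs. length xs = d}"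
  unfolding omega_pow_def Field_def by (auto dest: lexn_length)

lemma Well_order_omega_pow: "Well_order (omega_pow d)"
proof -
  have wf: "wf (lexn less_than d)"
    by (simp add: wf_lexn)
  have tr: "trans (lexn less_than d)"
    by (simp add: lexn_transI)
  have tot: "(xs, ys) \<in> lexn less_than d \<or> (ys, xs) \<in> lexn less_than d"
    if "length xs = d" "length ys = d" "xs \<noteq> ys" for xs ys
  proof -
    have "total (lenlex less_than)"
      by (simp add: total_lenlex)
    then have "(xs, ys) \<in> lenlex less_than \<or> (ys, xs) \<in> lenlex less_than"
      using that by (auto simp: total_on_def)
    then show ?thesis
      using that by (auto simp: lenlex_conv lex_conv lexn_conv)
  qed
  have "Refl (omega_pow d)"
    unfolding refl_on_def Field_omega_pow by (auto simp: omega_pow_def)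
  moreover have "trans (omega_pow d)"
    using tr unfolding omega_pow_def trans_def by blast
  moreover have "antisym (omega_pow d)"
    using wf tr unfolding omega_pow_def antisym_def
    by (auto dest: transD wf_not_sym)
  moreover have "Total (omega_pow d)"
    using tot unfolding total_on_def Field_omega_pow by (auto simp: omega_pow_def)
  moreover have "wf (omega_pow d - Id)"
    by (rule wf_subset[OF wf]) (auto simp: omega_pow_def)
  moreover have "omega_pow d \<subseteq> Field (omega_pow d) \<times> Field (omega_pow d)"
    by (auto simp: Field_def)
  ultimately show ?thesis
    by (simp add: well_order_on_def linear_order_on_def partial_order_on_def preorder_on_def)
qed

section \<open>Ordinal length of a module\<close>

definition nonzero_submodules ::
  "('a, 'm) ring_scheme \<Rightarrow> ('a, 'b, 'n) module_scheme \<Rightarrow> 'b set set" where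
  "nonzero_submodules R M = {N. submodule N R M \<and> N \<noteq> {\<zero>\<^bsub>M\<^esub>}}"

text \<open>Larger submodules come first.\<close>

definition rev_incl :: "'b set set \<Rightarrow> 'b set rel" where
  "rev_incl C = {(A, B). A \<in> C \<and> B \<in> C \<and> B \<subseteq> A}"

text \<open>\<open>has_olen R M r\<close> says that \<open>len(M)\<close> is the order type of \<open>r\<close>.\<close>

definition has_olen ::
  "('a, 'm) ring_scheme \<Rightarrow> ('a, 'b, 'n) module_scheme \<Rightarrow> 'c rel \<Rightarrow> bool" where
  "has_olen R M r \<longleftrightarrow>
     is_osup {rev_incl C | C. C \<subseteq> nonzero_submodules R M \<and> chain\<^sub>\<subseteq> C} r"

definition univalent ::
  "('a, 'm) ring_scheme \<Rightarrow> ('a, 'b, 'n) module_scheme \<Rightarrow> bool" where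
  "univalent R M \<longleftrightarrow> (\<exists>d. has_olen R M (omega_pow d))"

section \<open>Rings and modules\<close>

text \<open>A chain of \<open>n + 1\<close> primes has length \<open>n\<close>. The zero ring, which has no primes, counts as
  having finite dimension.\<close>

definition finite_krull_dim :: "('a, 'm) ring_scheme \<Rightarrow> bool" where
  "finite_krull_dim R \<longleftrightarrow>
     (\<exists>d. \<forall>C. C \<subseteq> {p. primeideal p R} \<and> chain\<^sub>\<subseteq> C \<longrightarrow> finite C \<and> card C \<le> Suc d)"

definition module_span ::
  "('a, 'm) ring_scheme \<Rightarrow> ('a, 'b, 'n) module_scheme \<Rightarrow> 'b set \<Rightarrow> 'b set" where
  "module_span R M S = \<Inter>{N. submodule N R M \<and> S \<subseteq> N}"

definition finitely_generated ::
  "('a, 'm) ring_scheme \<Rightarrow> ('a, 'b, 'n) module_scheme \<Rightarrow> bool" where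
  "finitely_generated R M \<longleftrightarrow>
     (\<exists>S. finite S \<and> S \<subseteq> carrier M \<and> module_span R M S = carrier M)"

definition annihilator ::
  "('a, 'm) ring_scheme \<Rightarrow> ('a, 'b, 'n) module_scheme \<Rightarrow> 'a set" where
  "annihilator R M = {r \<in> carrier R. \<forall>x\<in>carrier M. r \<odot>\<^bsub>M\<^esub> x = \<zero>\<^bsub>M\<^esub>}"

definition module_isomorphic ::
  "('a, 'm) ring_scheme \<Rightarrow> ('a, 'b, 'n) module_scheme \<Rightarrow> ('a, 'c, 'k) module_scheme \<Rightarrow> bool"
where
  "module_isomorphic R M N \<longleftrightarrow>
     (\<exists>f. bij_betw f (carrier M) (carrier N) \<and>
          (\<forall>x\<in>carrier M. \<forall>y\<in>carrier M. f (x \<oplus>\<^bsub>M\<^esub> y) = f x \<oplus>\<^bsub>N\<^esub> f y) \<and>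
          (\<forall>r\<in>carrier R. \<forall>x\<in>carrier M. f (r \<odot>\<^bsub>M\<^esub> x) = r \<odot>\<^bsub>N\<^esub> f x))"

text \<open>An ideal \<open>J\<close> of \<open>R Quot I\<close>, regarded as an \<open>R\<close>-module via \<open>R \<rightarrow> R Quot I\<close>.\<close>

definition quot_ideal_module ::
  "('a, 'm) ring_scheme \<Rightarrow> 'a set \<Rightarrow> 'a set set \<Rightarrow> ('a, 'a set) module" where
  "quot_ideal_module R I J =
     \<lparr>carrier = J, monoid.mult = monoid.mult (R Quot I), one = \<one>\<^bsub>R Quot I\<^esub>,
      ring.zero = \<zero>\<^bsub>R Quot I\<^esub>, ring.add = ring.add (R Quot I),
      smult = (\<lambda>r A. (I +>\<^bsub>R\<^esub> r) \<otimes>\<^bsub>R Quot I\<^esub> A)\<rparr>"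

end

theory Submission
  imports Defs
begin

text \<open>Upper bounds on lengths come from strictly antitone maps of a family of submodules into the
  \<open>d\<close>-tuples of natural numbers; they bound all chains at once, and coordinatewise addition of tuples
  plays the role of the natural sum. Such maps are glued along submodules \<open>L + Rx\<close> over \<open>L\<close> with
  \<open>(L : x)\<close> prime, and this shows that the nonzero ideals of \<open>R/p\<close> admit such a map for
  \<open>d = dim (R/p)\<close>. Conversely a chain of primes \<open>p = p\<^sub>0 \<subset> \<dots> \<subset> p\<^sub>d\<close> yields a chain of nonzero ideals of
  \<open>R/p\<close> whose order type \<open>\<omega>\<^sup>d\<close> is attained, which settles one direction.

  If \<open>len M = \<omega>\<^sup>d\<close> and \<open>N \<noteq> 0\<close>, then \<open>len (M/N) < \<omega>\<^sup>d\<close>: otherwise a prime \<open>(L : x)\<close> with \<open>N \<subseteq> L\<close> has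
  coheight at least \<open>d\<close>, and \<open>L\<close> can be appended to a chain of type \<open>\<omega>\<^sup>d\<close> above it. As the natural sum
  of two ordinals below \<open>\<omega>\<^sup>d\<close> is below \<open>\<omega>\<^sup>d\<close>, a nonzero multiplication map \<open>M \<rightarrow> M\<close> is injective and two
  nonzero cyclic submodules meet. So \<open>M\<close> is torsion-free of rank one over \<open>R/ann M\<close>, hence an ideal of it.\<close>

section \<open>Well-orders and lexicographic gradings\<close>

text \<open>If \<open>(h x, x) \<in> r\<close>, then \<open>mono\<close> gives
  \<open>(h (h x), h x) \<in> r\<close>, so \<open>h x\<close> is a counterexample below
  \<open>x\<close>; well-founded induction excludes this.\<close>

lemma wf_strict_mono_not_less:
  assumes wf: "wf r" and h: "\<And>x. x \<in> A \<Longrightarrow> h x \<in> A"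
    and mono: "\<And>x y. \<lbrakk>x \<in> A; y \<in> A; (x, y) \<in> r\<rbrakk> \<Longrightarrow> (h x, h y) \<in> r"
    and x: "x \<in> A"
  shows "(h x, x) \<notin> r"
  using wf x
proof (induction x rule: wf_induct_rule)
  case (less x)
  then show ?case using h mono by blast
qed

text \<open>The range of \<open>f\<close> need not be an initial segment. If \<open>s\<close> were
  shorter than \<open>r\<close>, an embedding \<open>g\<close> of \<open>s\<close> below some
  \<open>a\<close> would make \<open>f \<circ> g\<close> a strictly monotone self-map of
  \<open>s\<close> that lowers \<open>f a\<close>.\<close>

lemma strict_mono_imp_ordLeq:
  assumes r: "Well_order r" and s: "Well_order s"
    and f: "\<And>a. a \<in> Field r \<Longrightarrow> f a \<in> Field s"
    and mono: "\<And>a b. (a, b) \<in> r - Id \<Longrightarrow> (f a, f b) \<in> s - Id"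
  shows "r \<le>o s"
proof (rule ccontr)
  assume "\<not> r \<le>o s"
  then have "s <o r"
    using r s not_ordLeq_iff_ordLess by blast
  then obtain g where g: "embedS s r g"
    unfolding ordLess_def by blast
  then have emb: "embed s r g"
    unfolding embedS_def by blast
  then have sub: "g ` Field s \<subset> Field r"
    using embedS_iff[OF s] g by blast
  obtain a where a: "a \<in> Field r" "a \<notin> g ` Field s"
    using sub by blast
  have inj: "inj_on g (Field s)" and comp: "compat s r g" and fil: "wo_rel.ofilter r (g ` Field s)"
    using emb embed_iff_compat_inj_on_ofilter[OF s r] by auto
  \<comment> \<open>The range of \<open>g\<close> is closed downwards and misses \<open>a\<close>,
    so all of it lies below \<open>a\<close>.\<close>
  have below: "(g x, a) \<in> r - Id" if x: "x \<in> Field s" for x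
  proof -
    have gx: "g x \<in> Field r" using x sub by blast
    have "wo_rel r" using r by (simp add: wo_rel_def)
    then have "(g x, a) \<in> r \<or> (a, g x) \<in> r"
      using a(1) gx wo_rel.TOTALS by blast
    moreover have "(a, g x) \<notin> r"
      using fil a x wo_rel.ofilter_def[OF \<open>wo_rel r\<close>] by (auto simp: under_def)
    ultimately show ?thesis using a x by auto
  qed
  have "(f (g (f a)), f a) \<in> s - Id"
    using below f a(1) mono by blast
  moreover have "(f (g (f a)), f a) \<notin> s - Id"
  proof (rule wf_strict_mono_not_less[where A = "Field s" and h = "f \<circ> g", unfolded o_def])
    show "wf (s - Id)" using s by (simp add: well_order_on_def)
    show "f (g x) \<in> Field s" if "x \<in> Field s" for x
      using that sub f by blast
    show "(f (g x), f (g y)) \<in> s - Id" if "x \<in> Field s" "y \<in> Field s" "(x, y) \<in> s - Id" for x y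
    proof -
      have "(g x, g y) \<in> r - Id"
        using that comp inj by (auto simp: compat_def dest: inj_onD)
      then show ?thesis using mono by blast
    qed
    show "f a \<in> Field s" using f a by blast
  qed
  ultimately show False by blast
qed

lemma ordLeq_imp_strict_mono:
  assumes "r \<le>o s"
  obtains f where "\<And>a. a \<in> Field r \<Longrightarrow> f a \<in> Field s"
    and "\<And>a b. (a, b) \<in> r - Id \<Longrightarrow> (f a, f b) \<in> s - Id"
proof -
  from assms obtain f where r: "Well_order r" and s: "Well_order s" and emb: "embed r s f"
    unfolding ordLeq_def by blast
  then have inj: "inj_on f (Field r)" and comp: "compat r s f"
    using embed_iff_compat_inj_on_ofilter[OF r s] by auto
  show thesis
  proof
    show "f a \<in> Field s" if "a \<in> Field r" for a
      using embed_Field[OF emb] that by blast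
    show "(f a, f b) \<in> s - Id" if "(a, b) \<in> r - Id" for a b
      using that inj comp by (auto simp: compat_def inj_on_def Field_def)
  qed
qed

lemma Field_rev_incl: "Field (rev_incl C) = C"
  by (auto simp: rev_incl_def Field_def)

lemma rev_incl_minus_Id: "rev_incl C - Id = {(A, B). A \<in> C \<and> B \<in> C \<and> B \<subset> A}"
  by (auto simp: rev_incl_def)

text \<open>The chain inherits well-foundedness from \<open>s\<close> by pulling back along
  \<open>f\<close>; after that \<open>f\<close> is a strictly monotone map of well-orders.\<close>

lemma rev_incl_ordLeq:
  assumes s: "Well_order s" and C: "chain\<^sub>\<subseteq> C"
    and f: "\<And>A. A \<in> C \<Longrightarrow> f A \<in> Field s"
    and anti: "\<And>A B. \<lbrakk>A \<in> C; B \<in> C; A \<subset> B\<rbrakk> \<Longrightarrow> (f B, f A) \<in> s - Id"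
  shows "rev_incl C \<le>o s"
proof (rule strict_mono_imp_ordLeq[OF _ s])
  have "wf (s - Id)" using s by (simp add: well_order_on_def)
  then have "wf (inv_image (s - Id) f)" by (rule wf_inv_image)
  then have "wf (rev_incl C - Id)"
    by (rule wf_subset) (use anti in \<open>auto simp: rev_incl_minus_Id inv_image_def\<close>)
  moreover have "Refl (rev_incl C)" "trans (rev_incl C)" "antisym (rev_incl C)"
    by (auto simp: refl_on_def trans_def antisym_def rev_incl_def Field_def)
  moreover have "Total (rev_incl C)"
    using C unfolding total_on_def Field_rev_incl
    by (auto simp: rev_incl_def chain_subset_def)
  moreover have "rev_incl C \<subseteq> Field (rev_incl C) \<times> Field (rev_incl C)"
    by (auto simp: Field_def)
  ultimately show "Well_order (rev_incl C)"
    by (simp add: well_order_on_def linear_order_on_def partial_order_on_def preorder_on_def)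
  show "f A \<in> Field s" if "A \<in> Field (rev_incl C)" for A
    using that f by (simp add: Field_rev_incl)
  show "(f A, f B) \<in> s - Id" if "(A, B) \<in> rev_incl C - Id" for A B
    using that anti unfolding rev_incl_minus_Id by blast
qed

section \<open>Lexicographic comparison of tuples of equal length\<close>

abbreviation lexless :: "nat list \<Rightarrow> nat list \<Rightarrow> bool" where
  "lexless xs ys \<equiv> (xs, ys) \<in> lex less_than"

lemma omega_pow_minus_Id:
  "omega_pow d - Id = {(xs, ys). length xs = d \<and> length ys = d \<and> lexless xs ys}"
proof -
  have "lexless xs ys \<Longrightarrow> xs \<noteq> ys" for xs ys
    using irrefl_lex[of less_than] by (auto simp: irrefl_def)
  moreover have "lexn less_than d = {(xs, ys). length xs = d \<and> length ys = d \<and> lexless xs ys}"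
    using lexn_length unfolding lex_def by blast
  ultimately show ?thesis
    unfolding omega_pow_def by blast
qed

lemma lexless_total: "length xs = length ys \<Longrightarrow> xs \<noteq> ys \<Longrightarrow> lexless xs ys \<or> lexless ys xs"
  by (induction xs ys rule: list_induct2) auto

lemma lexless_trans: "lexless xs ys \<Longrightarrow> lexless ys zs \<Longrightarrow> lexless xs zs"
  by (rule transD[OF lex_transI[OF trans_less_than]])

lemma lexless_not_sym: "lexless xs ys \<Longrightarrow> \<not> lexless ys xs"
  by (rule wf_not_sym[OF wf_lex[OF wf_less_than]])

text \<open>Read as coefficients of Cantor normal forms below \<open>\<omega>\<^sup>d\<close>,
  tuples add coordinatewise as ordinals do under the natural sum, which is strictly monotone in each
  argument. Either the sum of the leading entries grows, or both leading entries agree and the tails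
  decide.\<close>

lemma lexless_map2_add:
  assumes "length xs = n" "length xs' = n" "length ys = n" "length ys' = n"
    and "xs = xs' \<or> lexless xs xs'" and "ys = ys' \<or> lexless ys ys'"
    and "xs \<noteq> xs' \<or> ys \<noteq> ys'"
  shows "lexless (map2 (+) xs ys) (map2 (+) xs' ys')"
  using assms
proof (induction n arbitrary: xs xs' ys ys')
  case (Suc n)
  obtain x us x' us' y vs y' vs' where eq: "xs = x # us" "xs' = x' # us'" "ys = y # vs" "ys' = y' # vs'"
    and len: "length us = n" "length us' = n" "length vs = n" "length vs' = n"
    using Suc.prems(1-4) by (auto simp: length_Suc_conv)
  show ?case
    using Suc.IH[OF len] Suc.prems(5-) len unfolding eq by (auto simp del: map2_map_map)
qed simp

lemma lexless_least:
  assumes "P xs"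
  obtains ys where "P ys" and "\<And>zs. lexless zs ys \<Longrightarrow> \<not> P zs"
  using wfE_min[OF wf_lex[OF wf_less_than], of xs "Collect P" thesis] assms by simp

section \<open>Gradings of families of sets by tuples\<close>

definition omega_graded :: "nat \<Rightarrow> 'b set set \<Rightarrow> bool" where
  "omega_graded d U \<longleftrightarrow>
     (\<exists>f. (\<forall>A\<in>U. length (f A) = d) \<and> (\<forall>A\<in>U. \<forall>B\<in>U. A \<subset> B \<longrightarrow> lexless (f B) (f A)))"

lemma omega_gradedI:
  assumes "\<And>A. A \<in> U \<Longrightarrow> length (f A) = d"
    and "\<And>A B. \<lbrakk>A \<in> U; B \<in> U; A \<subset> B\<rbrakk> \<Longrightarrow> lexless (f B) (f A)"
  shows "omega_graded d U"
  using assms unfolding omega_graded_def by blast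

lemma omega_gradedE:
  assumes "omega_graded d U"
  obtains f where "\<And>A. A \<in> U \<Longrightarrow> length (f A) = d"
    and "\<And>A B. \<lbrakk>A \<in> U; B \<in> U; A \<subset> B\<rbrakk> \<Longrightarrow> lexless (f B) (f A)"
proof -
  obtain f where "\<forall>A\<in>U. length (f A) = d" "\<forall>A\<in>U. \<forall>B\<in>U. A \<subset> B \<longrightarrow> lexless (f B) (f A)"
    using assms unfolding omega_graded_def by blast
  then show thesis by (intro that[of f]) simp_all
qed

lemma omega_graded_chain:
  assumes "omega_graded d U" and "C \<subseteq> U" and "chain\<^sub>\<subseteq> C"
  shows "rev_incl C \<le>o omega_pow d"
proof -
  obtain f where "\<And>A. A \<in> U \<Longrightarrow> length (f A) = d"
    and "\<And>A B. \<lbrakk>A \<in> U; B \<in> U; A \<subset> B\<rbrakk> \<Longrightarrow> lexless (f B) (f A)"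
    by (rule omega_gradedE[OF assms(1)]) blast
  with assms(2,3) show ?thesis
    by (intro rev_incl_ordLeq[where f = f] Well_order_omega_pow)
       (auto simp: Field_omega_pow omega_pow_minus_Id subset_iff)
qed

lemma omega_graded_le:
  assumes "omega_graded d Y" and "\<And>A. A \<in> U \<Longrightarrow> g A \<in> Y"
    and "\<And>A B. \<lbrakk>A \<in> U; B \<in> U; A \<subset> B\<rbrakk> \<Longrightarrow> g A \<subset> g B"
  shows "omega_graded d U"
proof -
  obtain f where f: "\<And>A. A \<in> Y \<Longrightarrow> length (f A) = d"
    "\<And>A B. \<lbrakk>A \<in> Y; B \<in> Y; A \<subset> B\<rbrakk> \<Longrightarrow> lexless (f B) (f A)"
    by (rule omega_gradedE[OF assms(1)]) blast
  show ?thesis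
    by (rule omega_gradedI[where f = "\<lambda>A. f (g A)"]) (simp_all add: f assms(2,3))
qed

lemma omega_graded_subset:
  "omega_graded d V \<Longrightarrow> U \<subseteq> V \<Longrightarrow> omega_graded d U"
  unfolding omega_graded_def by (meson subsetD)

text \<open>The two gradings are added coordinatewise. At a proper inclusion at least one of the two
  images grows properly, so the sum drops strictly. With submodules this becomes the bound of
  \<open>len M\<close> by the natural sum of the lengths of a submodule and its quotient.\<close>

lemma omega_graded_prod:
  assumes Y: "omega_graded d Y" and Z: "omega_graded d Z"
    and g: "\<And>A. A \<in> U \<Longrightarrow> g A \<in> Y" and h: "\<And>A. A \<in> U \<Longrightarrow> h A \<in> Z"
    and mono: "\<And>A B. \<lbrakk>A \<in> U; B \<in> U; A \<subseteq> B\<rbrakk> \<Longrightarrow> g A \<subseteq> g B \<and> h A \<subseteq> h B"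
    and inj: "\<And>A B. \<lbrakk>A \<in> U; B \<in> U; A \<subseteq> B; g A = g B; h A = h B\<rbrakk> \<Longrightarrow> A = B"
  shows "omega_graded d U"
proof -
  obtain u where u: "\<And>A. A \<in> Y \<Longrightarrow> length (u A) = d"
      "\<And>A B. \<lbrakk>A \<in> Y; B \<in> Y; A \<subset> B\<rbrakk> \<Longrightarrow> lexless (u B) (u A)"
    by (rule omega_gradedE[OF Y]) blast
  obtain v where v: "\<And>A. A \<in> Z \<Longrightarrow> length (v A) = d"
      "\<And>A B. \<lbrakk>A \<in> Z; B \<in> Z; A \<subset> B\<rbrakk> \<Longrightarrow> lexless (v B) (v A)"
    by (rule omega_gradedE[OF Z]) blast
  have irr: "\<not> lexless xs xs" for xs using lexless_not_sym by blast
  show ?thesis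
  proof (rule omega_gradedI[where f = "\<lambda>A. map2 (+) (u (g A)) (v (h A))"])
    fix A B assume AB: "A \<in> U" "B \<in> U" "A \<subset> B"
    show "lexless (map2 (+) (u (g B)) (v (h B))) (map2 (+) (u (g A)) (v (h A)))"
    proof (rule lexless_map2_add[of _ d])
      show "u (g B) = u (g A) \<or> lexless (u (g B)) (u (g A))"
        using mono[of A B] u(2)[of "g A" "g B"] g AB by (metis psubset_eq)
      show "v (h B) = v (h A) \<or> lexless (v (h B)) (v (h A))"
        using mono[of A B] v(2)[of "h A" "h B"] h AB by (metis psubset_eq)
      have "g A \<subset> g B \<or> h A \<subset> h B"
        using mono[of A B] inj[of A B] AB by blast
      then show "u (g B) \<noteq> u (g A) \<or> v (h B) \<noteq> v (h A)"
        using u(2)[of "g A" "g B"] v(2)[of "h A" "h B"] g h AB irr by metis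
    qed (use u v g h AB in auto)
  qed (use u v g h in auto)
qed

text \<open>The grading sends \<open>I\<close> to the least value that a grading of the members above \<open>I\<close> can take
  at \<open>I\<close>.\<close>

lemma omega_graded_local:
  assumes "\<And>I. I \<in> U \<Longrightarrow> omega_graded d {A \<in> U. I \<subseteq> A}"
  shows "omega_graded d U"
proof -
  define G where "G I f \<longleftrightarrow> (\<forall>A\<in>U. I \<subseteq> A \<longrightarrow> length (f A) = d) \<and>
    (\<forall>A\<in>U. \<forall>B\<in>U. I \<subseteq> A \<and> A \<subset> B \<longrightarrow> lexless (f B) (f A))" for I and f :: "'a set \<Rightarrow> nat list"
  define P where "P I v \<longleftrightarrow> (\<exists>f. G I f \<and> f I = v)" for I v
  have "\<exists>v. P I v \<and> (\<forall>w. lexless w v \<longrightarrow> \<not> P I w)" if I: "I \<in> U" for I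
  proof -
    obtain f where "\<forall>A\<in>{A \<in> U. I \<subseteq> A}. length (f A) = d"
      "\<forall>A\<in>{A \<in> U. I \<subseteq> A}. \<forall>B\<in>{A \<in> U. I \<subseteq> A}. A \<subset> B \<longrightarrow> lexless (f B) (f A)"
      using assms[OF I] unfolding omega_graded_def by blast
    then have "G I f" unfolding G_def by simp (meson order_trans psubset_imp_subset)
    then have "P I (f I)" unfolding P_def by blast
    then show ?thesis using lexless_least[of "P I"] by metis
  qed
  then obtain v where v: "\<And>I. I \<in> U \<Longrightarrow> P I (v I)"
    and least: "\<And>I w. I \<in> U \<Longrightarrow> lexless w (v I) \<Longrightarrow> \<not> P I w"
    by metis
  have len: "length (v I) = d" if "I \<in> U" for I
    using v[OF that] that unfolding P_def G_def by (metis order_refl)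
  show ?thesis
  proof (rule omega_gradedI[of _ v])
    fix A B assume AB: "A \<in> U" "B \<in> U" "A \<subset> B"
    obtain f where f: "G A f" "f A = v A" using v[OF AB(1)] unfolding P_def by blast
    \<comment> \<open>A grading above \<open>A\<close> is also one above \<open>B\<close>, so it
      competes for the least value at \<open>B\<close>: \<open>v B\<close> is at most
      \<open>f B\<close>, which is less than \<open>f A = v A\<close>.\<close>
    have "G B f" using f(1) AB(3) unfolding G_def by (meson order_trans psubset_imp_subset)
    then have "P B (f B)" unfolding P_def by blast
    then have "\<not> lexless (f B) (v B)" using least[OF AB(2)] by blast
    moreover have "length (f B) = d" using f(1) AB unfolding G_def by (meson psubset_imp_subset)
    ultimately have "f B = v B \<or> lexless (v B) (f B)"
      using lexless_total[of "f B" "v B"] len AB by auto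
    moreover have "lexless (f B) (v A)" using f AB unfolding G_def by (metis order_refl)
    ultimately show "lexless (v B) (v A)" using lexless_trans by metis
  qed (use len in blast)
qed

text \<open>A new leading coordinate makes room for \<open>q\<close>: it receives
  \<open>1 # replicate d 0\<close>, that is \<open>\<omega>\<^sup>d\<close>, while the members
  properly above it keep their values below \<open>\<omega>\<^sup>d\<close>.\<close>

lemma omega_graded_insert_least:
  assumes "omega_graded d {A \<in> U. q \<subset> A}"
  shows "omega_graded (Suc d) {A \<in> U. q \<subseteq> A}"
proof -
  obtain f where f: "\<And>A. A \<in> U \<Longrightarrow> q \<subset> A \<Longrightarrow> length (f A) = d"
    "\<And>A B. \<lbrakk>A \<in> U; B \<in> U; q \<subset> A; q \<subset> B; A \<subset> B\<rbrakk> \<Longrightarrow> lexless (f B) (f A)"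
    using omega_gradedE[OF assms] by (metis (no_types, lifting) mem_Collect_eq)
  show ?thesis
    by (rule omega_gradedI[where f = "\<lambda>A. if A = q then 1 # replicate d 0 else 0 # f A"])
       (use f in \<open>auto simp: psubset_eq\<close>)
qed

section \<open>Ascending sequences, and copies of \<open>\<omega>\<^sup>d\<close> inside chains of
  sets\<close>

lemma wf_if_no_ascending:
  assumes "\<And>f. \<lbrakk>\<And>i. f i \<in> U; \<And>i. f i \<subset> f (Suc i)\<rbrakk> \<Longrightarrow> False"
  shows "wf {(B, A). A \<in> U \<and> B \<in> U \<and> A \<subset> B}"
  unfolding wf_iff_no_infinite_down_chain
proof
  assume "\<exists>f. \<forall>i::nat. (f (Suc i), f i) \<in> {(B, A). A \<in> U \<and> B \<in> U \<and> A \<subset> B}"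
  then obtain f where "\<And>i::nat. (f (Suc i), f i) \<in> {(B, A). A \<in> U \<and> B \<in> U \<and> A \<subset> B}"
    by blast
  then show False using assms[of f] by simp
qed

lemma chain_subset_antitone_range:
  assumes "\<And>xs ys. \<lbrakk>length xs = d; length ys = d; lexless xs ys\<rbrakk> \<Longrightarrow> G ys \<subset> G xs"
  shows "chain\<^sub>\<subseteq> (G ` {xs. length xs = d})"
  unfolding chain_subset_def
proof (intro ballI)
  fix A B assume "A \<in> G ` {xs. length xs = d}" "B \<in> G ` {xs. length xs = d}"
  then obtain xs ys where "A = G xs" "B = G ys" "length xs = d" "length ys = d" by blast
  then show "A \<subseteq> B \<or> B \<subseteq> A"
    using assms[of xs ys] assms[of ys xs] lexless_total[of xs ys] by (cases "xs = ys") auto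
qed

lemma omega_pow_self_map:
  assumes "\<And>xs. length xs = d \<Longrightarrow> length (h xs) = d"
    and "\<And>xs ys. \<lbrakk>length xs = d; length ys = d; lexless xs ys\<rbrakk> \<Longrightarrow> lexless (h xs) (h ys)"
    and "length xs = d"
  shows "\<not> lexless (h xs) xs"
  using wf_strict_mono_not_less[OF wf_lex[OF wf_less_than], of "{xs. length xs = d}" h xs] assms
  by simp

text \<open>A chain containing a copy of \<open>\<omega>\<^sup>d\<close> and one further member has order type at least
  \<open>\<omega>\<^sup>d + 1\<close>.\<close>

lemma not_rev_incl_ordLeq_omega_pow:
  assumes above: "\<And>xs. length xs = d \<Longrightarrow> N \<subset> G xs"
    and anti: "\<And>xs ys. \<lbrakk>length xs = d; length ys = d; lexless xs ys\<rbrakk> \<Longrightarrow> G ys \<subset> G xs"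
  shows "\<not> rev_incl (insert N (G ` {xs. length xs = d})) \<le>o omega_pow d"
proof
  let ?C = "insert N (G ` {xs. length xs = d})"
  assume "rev_incl ?C \<le>o omega_pow d"
  then obtain f where f0: "\<And>A. A \<in> Field (rev_incl ?C) \<Longrightarrow> f A \<in> Field (omega_pow d)"
    and mono0: "\<And>A B. (A, B) \<in> rev_incl ?C - Id \<Longrightarrow> (f A, f B) \<in> omega_pow d - Id"
    by (rule ordLeq_imp_strict_mono) blast
  have f: "length (f A) = d" if "A \<in> ?C" for A
    using f0[of A] that by (simp only: Field_rev_incl Field_omega_pow mem_Collect_eq)
  have mono: "lexless (f A) (f B)" if "A \<in> ?C" "B \<in> ?C" "B \<subset> A" for A B
    using mono0[of A B] that by (simp only: rev_incl_minus_Id omega_pow_minus_Id mem_Collect_eq prod.case)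
  \<comment> \<open>\<open>f \<circ> G\<close> is a strictly monotone self-map of the tuples, so it
    cannot lower \<open>f N\<close>; but \<open>G (f N)\<close> precedes \<open>N\<close> in the
    chain, so its value is below \<open>f N\<close>.\<close>
  have "\<not> lexless (f (G (f N))) (f N)"
    by (rule omega_pow_self_map[where h = "\<lambda>xs. f (G xs)"]) (use f mono anti in auto)
  moreover have "lexless (f (G (f N))) (f N)"
    using f[of N] above by (intro mono) auto
  ultimately show False by blast
qed

section \<open>Submodules and colon ideals\<close>

lemma (in cring) idealI_closed:
  assumes "I \<subseteq> carrier R" and "\<zero> \<in> I" and "\<And>a b. \<lbrakk>a \<in> I; b \<in> I\<rbrakk> \<Longrightarrow> a \<oplus> b \<in> I"
    and smult: "\<And>r a. \<lbrakk>r \<in> carrier R; a \<in> I\<rbrakk> \<Longrightarrow> r \<otimes> a \<in> I"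
  shows "ideal I R"
proof (rule idealI)
  \<comment> \<open>Additive inverses arise from multiplication by
    \<open>\<ominus> \<one>\<close>.\<close>
  have "\<ominus> a \<in> I" if "a \<in> I" for a
    using smult[of "\<ominus> \<one>" a] that assms(1) by (auto simp: l_minus)
  then show "subgroup I (add_monoid R)"
    using assms by (auto intro!: subgroup.intro simp: a_inv_def)
  show "a \<otimes> r \<in> I" if "a \<in> I" "r \<in> carrier R" for a r
    using smult that assms(1) m_comm by (metis subsetD)
qed (use smult ring_axioms in auto)

lemma (in module) submoduleI_closed:
  assumes "H \<subseteq> carrier M" and "\<zero>\<^bsub>M\<^esub> \<in> H" and "\<And>a b. \<lbrakk>a \<in> H; b \<in> H\<rbrakk> \<Longrightarrow> a \<oplus>\<^bsub>M\<^esub> b \<in> H"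
    and smult: "\<And>r a. \<lbrakk>r \<in> carrier R; a \<in> H\<rbrakk> \<Longrightarrow> r \<odot>\<^bsub>M\<^esub> a \<in> H"
  shows "submodule H R M"
proof (rule submoduleI)
  show "\<ominus>\<^bsub>M\<^esub> a \<in> H" if "a \<in> H" for a
    using smult[of "\<ominus> \<one>" a] that assms(1) by (auto simp: smult_l_minus)
qed (use assms in auto)

lemma (in module) submodule_zero: "submodule N R M \<Longrightarrow> \<zero>\<^bsub>M\<^esub> \<in> N"
  using submoduleE(2,3,5) submoduleE(1) M.r_neg by (metis all_not_in_conv subsetD)

lemma (in module) submodule_minus:
  "\<lbrakk>submodule N R M; a \<in> N; b \<in> N\<rbrakk> \<Longrightarrow> a \<ominus>\<^bsub>M\<^esub> b \<in> N"
  unfolding a_minus_def using submoduleE(3,5) by metis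

lemma (in module) smult_minus_distr:
  "\<lbrakk>a \<in> carrier R; b \<in> carrier R; x \<in> carrier M\<rbrakk> \<Longrightarrow>
    (a \<ominus> b) \<odot>\<^bsub>M\<^esub> x = a \<odot>\<^bsub>M\<^esub> x \<ominus>\<^bsub>M\<^esub> b \<odot>\<^bsub>M\<^esub> x"
  by (simp add: R.minus_eq M.minus_eq smult_l_distr smult_l_minus)

lemma (in module) smult_minus_distr2:
  "\<lbrakk>a \<in> carrier R; x \<in> carrier M; y \<in> carrier M\<rbrakk> \<Longrightarrow>
    a \<odot>\<^bsub>M\<^esub> (x \<ominus>\<^bsub>M\<^esub> y) = a \<odot>\<^bsub>M\<^esub> x \<ominus>\<^bsub>M\<^esub> a \<odot>\<^bsub>M\<^esub> y"
  by (simp add: M.minus_eq smult_r_distr smult_r_minus)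

lemma (in module) smult_left_commute:
  "\<lbrakk>a \<in> carrier R; b \<in> carrier R; x \<in> carrier M\<rbrakk> \<Longrightarrow>
    a \<odot>\<^bsub>M\<^esub> (b \<odot>\<^bsub>M\<^esub> x) = b \<odot>\<^bsub>M\<^esub> (a \<odot>\<^bsub>M\<^esub> x)"
  using smult_assoc1[of a b x] smult_assoc1[of b a x] R.m_comm[of a b] by simp

lemma (in abelian_group) minus_add_cancel':
  "\<lbrakk>x \<in> carrier G; y \<in> carrier G\<rbrakk> \<Longrightarrow> (x \<oplus> y) \<ominus> x = y"
  by (simp add: minus_eq a_comm[of x y] a_assoc r_neg)

lemma (in abelian_group) minus_eq_zero_iff:
  "\<lbrakk>x \<in> carrier G; y \<in> carrier G\<rbrakk> \<Longrightarrow> x \<ominus> y = \<zero> \<longleftrightarrow> x = y"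
  using add.inv_solve_right[of \<zero> x y] by (auto simp: minus_eq)

lemma set_addI: "\<lbrakk>a \<in> A; b \<in> B\<rbrakk> \<Longrightarrow> a \<oplus>\<^bsub>G\<^esub> b \<in> A <+>\<^bsub>G\<^esub> B"
  by (auto simp: set_add_def')

lemma set_addE:
  assumes "x \<in> A <+>\<^bsub>G\<^esub> B"
  obtains a b where "x = a \<oplus>\<^bsub>G\<^esub> b" and "a \<in> A" and "b \<in> B"
  using assms by (auto simp: set_add_def')

text \<open>The annihilator of the class of \<open>x\<close> in \<open>M/N\<close>; thus
  \<open>(N + Rx)/N\<close> is a copy of \<open>R\<close> modulo this ideal.\<close>

definition colon :: "('a, 'm) ring_scheme \<Rightarrow> ('a, 'b, 'n) module_scheme \<Rightarrow> 'b set \<Rightarrow> 'b \<Rightarrow> 'a set"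
  where "colon R M N x = {r \<in> carrier R. r \<odot>\<^bsub>M\<^esub> x \<in> N}"

lemma (in module) ideal_colon:
  assumes N: "submodule N R M" and x: "x \<in> carrier M"
  shows "ideal (colon R M N x) R"
proof (rule R.idealI_closed)
  show "r \<otimes> a \<in> colon R M N x" if "r \<in> carrier R" "a \<in> colon R M N x" for r a
    using that x submoduleE(4)[OF N] by (auto simp: colon_def smult_assoc1)
qed (use x submoduleE(5)[OF N] submodule_zero[OF N] in \<open>auto simp: colon_def smult_l_distr\<close>)

lemma (in module) submodule_add:
  assumes A: "submodule A R M" and B: "submodule B R M"
  shows "submodule (A <+>\<^bsub>M\<^esub> B) R M"
proof (rule submoduleI_closed)
  note sub = subsetD[OF submoduleE(1)[OF A]] subsetD[OF submoduleE(1)[OF B]]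
  show "A <+>\<^bsub>M\<^esub> B \<subseteq> carrier M"
    using sub by (auto simp: set_add_def')
  show "\<zero>\<^bsub>M\<^esub> \<in> A <+>\<^bsub>M\<^esub> B"
    using submodule_zero[OF A] submodule_zero[OF B] M.l_zero[OF M.zero_closed]
    unfolding set_add_def' by force
  show "u \<oplus>\<^bsub>M\<^esub> v \<in> A <+>\<^bsub>M\<^esub> B" if uv: "u \<in> A <+>\<^bsub>M\<^esub> B" "v \<in> A <+>\<^bsub>M\<^esub> B" for u v
  proof -
    obtain a b a' b' where eq: "u = a \<oplus>\<^bsub>M\<^esub> b" "v = a' \<oplus>\<^bsub>M\<^esub> b'"
      and m: "a \<in> A" "b \<in> B" "a' \<in> A" "b' \<in> B"
      using uv by (elim set_addE) blast
    have "u \<oplus>\<^bsub>M\<^esub> v = (a \<oplus>\<^bsub>M\<^esub> a') \<oplus>\<^bsub>M\<^esub> (b \<oplus>\<^bsub>M\<^esub> b')"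
      using m sub by (simp add: eq M.a_ac)
    then show ?thesis
      using submoduleE(5)[OF A] submoduleE(5)[OF B] m set_addI by metis
  qed
  show "r \<odot>\<^bsub>M\<^esub> u \<in> A <+>\<^bsub>M\<^esub> B" if r: "r \<in> carrier R" and u: "u \<in> A <+>\<^bsub>M\<^esub> B" for r u
  proof -
    obtain a b where eq: "u = a \<oplus>\<^bsub>M\<^esub> b" and m: "a \<in> A" "b \<in> B"
      using u by (elim set_addE) blast
    have "r \<odot>\<^bsub>M\<^esub> u = r \<odot>\<^bsub>M\<^esub> a \<oplus>\<^bsub>M\<^esub> r \<odot>\<^bsub>M\<^esub> b"
      using m sub r by (simp add: eq smult_r_distr)
    then show ?thesis
      using submoduleE(4)[OF A] submoduleE(4)[OF B] m r set_addI by metis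
  qed
qed

lemma (in module) set_add_upper:
  assumes A: "submodule A R M" and B: "submodule B R M"
  shows "A \<subseteq> A <+>\<^bsub>M\<^esub> B" and "B \<subseteq> A <+>\<^bsub>M\<^esub> B"
proof -
  note sub = subsetD[OF submoduleE(1)[OF A]] subsetD[OF submoduleE(1)[OF B]]
  show "A \<subseteq> A <+>\<^bsub>M\<^esub> B"
    using submodule_zero[OF B] M.r_zero[OF sub(1)] unfolding set_add_def' by force
  show "B \<subseteq> A <+>\<^bsub>M\<^esub> B"
    using submodule_zero[OF A] M.l_zero[OF sub(2)] unfolding set_add_def' by force
qed

text \<open>The modular law: \<open>b \<in> B\<close> is some \<open>a + n\<close>, and
  \<open>n = b - a\<close> lies in \<open>B \<inter> N\<close>, hence in \<open>A\<close>. A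
  submodule is thus determined, among those comparable to it, by its sum with \<open>N\<close> and
  its intersection with \<open>N\<close>.\<close>

lemma (in module) submodule_modular:
  assumes A: "submodule A R M" and B: "submodule B R M" and N: "submodule N R M"
    and "A \<subseteq> B" and sum: "B \<subseteq> A <+>\<^bsub>M\<^esub> N" and int: "B \<inter> N \<subseteq> A"
  shows "A = B"
proof
  show "B \<subseteq> A"
  proof
    fix b assume b: "b \<in> B"
    then obtain a n where an: "b = a \<oplus>\<^bsub>M\<^esub> n" "a \<in> A" "n \<in> N"
      using sum by (meson set_addE subsetD)
    have mem: "a \<in> carrier M" "n \<in> carrier M"
      using an submoduleE(1)[OF A] submoduleE(1)[OF N] by auto
    have "b \<ominus>\<^bsub>M\<^esub> a = n"
      using mem by (simp add: an(1) M.minus_add_cancel')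
    moreover have "b \<ominus>\<^bsub>M\<^esub> a \<in> B"
      using submodule_minus[OF B] b an(2) \<open>A \<subseteq> B\<close> by blast
    ultimately have "n \<in> A" using int an(3) by auto
    then show "b \<in> A" using an submoduleE(5)[OF A] by blast
  qed
qed fact

definition smult_image :: "('a, 'b, 'n) module_scheme \<Rightarrow> 'a set \<Rightarrow> 'b \<Rightarrow> 'b set"
  where "smult_image M I x = (\<lambda>r. r \<odot>\<^bsub>M\<^esub> x) ` I"

lemma (in module) submodule_smult_image:
  assumes I: "ideal I R" and x: "x \<in> carrier M"
  shows "submodule (smult_image M I x) R M"
proof (rule submoduleI_closed)
  interpret ideal I R by fact
  show "smult_image M I x \<subseteq> carrier M"
    using x a_subset by (auto simp: smult_image_def)
  show "\<zero>\<^bsub>M\<^esub> \<in> smult_image M I x"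
    using x smult_l_null additive_subgroup.zero_closed[OF is_additive_subgroup]
    unfolding smult_image_def by (metis imageI)
  show "u \<oplus>\<^bsub>M\<^esub> v \<in> smult_image M I x" if uv: "u \<in> smult_image M I x" "v \<in> smult_image M I x" for u v
  proof -
    obtain a b where "u = a \<odot>\<^bsub>M\<^esub> x" "v = b \<odot>\<^bsub>M\<^esub> x" "a \<in> I" "b \<in> I"
      using uv unfolding smult_image_def by blast
    moreover from this have "u \<oplus>\<^bsub>M\<^esub> v = (a \<oplus> b) \<odot>\<^bsub>M\<^esub> x"
      using x by (simp add: smult_l_distr Icarr)
    ultimately show ?thesis unfolding smult_image_def by (auto intro: a_closed)
  qed
  show "r \<odot>\<^bsub>M\<^esub> u \<in> smult_image M I x" if r: "r \<in> carrier R" and u: "u \<in> smult_image M I x" for r u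
  proof -
    obtain a where "u = a \<odot>\<^bsub>M\<^esub> x" "a \<in> I"
      using u unfolding smult_image_def by blast
    moreover from this have "r \<odot>\<^bsub>M\<^esub> u = (r \<otimes> a) \<odot>\<^bsub>M\<^esub> x"
      using x r by (simp add: smult_assoc1 Icarr)
    ultimately show ?thesis unfolding smult_image_def using r by (auto intro: I_l_closed)
  qed
qed

lemma (in module) mem_smult_image_carrier:
  "x \<in> carrier M \<Longrightarrow> x \<in> smult_image M (carrier R) x"
  unfolding smult_image_def using smult_one by force

lemma (in module) submodule_Int:
  "\<lbrakk>submodule A R M; submodule B R M\<rbrakk> \<Longrightarrow> submodule (A \<inter> B) R M"
  by (rule submoduleI_closed) (auto simp: submodule_zero submoduleE(4,5) dest: submoduleE(1))

lemma (in module) submodule_smult_vimage: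
  assumes A: "submodule A R M" and s: "s \<in> carrier R"
  shows "submodule {m \<in> carrier M. s \<odot>\<^bsub>M\<^esub> m \<in> A} R M"
proof (rule submoduleI_closed)
  show "r \<odot>\<^bsub>M\<^esub> m \<in> {m \<in> carrier M. s \<odot>\<^bsub>M\<^esub> m \<in> A}"
    if "r \<in> carrier R" "m \<in> {m \<in> carrier M. s \<odot>\<^bsub>M\<^esub> m \<in> A}" for r m
    using that s submoduleE(4)[OF A] by (simp add: smult_left_commute[of s])
qed (use s submoduleE(5)[OF A] submodule_zero[OF A] in \<open>auto simp: smult_r_distr\<close>)

lemma (in module) submodule_singleton_zero: "submodule {\<zero>\<^bsub>M\<^esub>} R M"
  by (rule submoduleI_closed) auto

lemma (in module) submodule_smult_range:
  assumes s: "s \<in> carrier R"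
  shows "submodule ((\<lambda>m. s \<odot>\<^bsub>M\<^esub> m) ` carrier M) R M"
proof (rule submoduleI_closed)
  show "\<zero>\<^bsub>M\<^esub> \<in> (\<lambda>m. s \<odot>\<^bsub>M\<^esub> m) ` carrier M"
    using s smult_r_null M.zero_closed by (metis imageI)
  show "u \<oplus>\<^bsub>M\<^esub> v \<in> (\<lambda>m. s \<odot>\<^bsub>M\<^esub> m) ` carrier M"
    if "u \<in> (\<lambda>m. s \<odot>\<^bsub>M\<^esub> m) ` carrier M" "v \<in> (\<lambda>m. s \<odot>\<^bsub>M\<^esub> m) ` carrier M" for u v
    using that s smult_r_distr[of s, symmetric] by auto
  show "r \<odot>\<^bsub>M\<^esub> u \<in> (\<lambda>m. s \<odot>\<^bsub>M\<^esub> m) ` carrier M"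
    if "r \<in> carrier R" "u \<in> (\<lambda>m. s \<odot>\<^bsub>M\<^esub> m) ` carrier M" for r u
    using that s smult_left_commute[of r s] by auto
qed (use s in auto)

section \<open>Associated primes and upper bounds\<close>

lemma (in noetherian_ring) wf_ideals:
  "wf {(J, I). ideal I R \<and> ideal J R \<and> I \<subset> J}"
proof -
  have "wf {(J, I). I \<in> {I. ideal I R} \<and> J \<in> {I. ideal I R} \<and> I \<subset> J}"
  proof (rule wf_if_no_ascending)
    fix f assume f: "\<And>i. f i \<in> {I. ideal I R}" "\<And>i. f i \<subset> f (Suc i)"
    have mono: "f i \<subseteq> f j" if "i \<le> j" for i j
      using lift_Suc_mono_le[of f] f(2) that by blast
    have "subset.chain {I. ideal I R} (range f)"
      unfolding subset_chain_def using f(1) mono nat_le_linear by (metis image_iff image_subsetI)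
    \<comment> \<open>The union of the sequence would be one of its terms, which the next term
      exceeds.\<close>
    then have "\<Union>(range f) \<in> range f"
      using ideal_chain_is_trivial[of "range f"] by blast
    then show False using f(2) by blast
  qed
  then show ?thesis by simp
qed

text \<open>An ideal maximal among the \<open>(N : y)\<close> with \<open>y \<notin> N\<close> is
  prime: if \<open>ab \<in> (N : x)\<close> and \<open>b \<notin> (N : x)\<close>, then
  \<open>(N : bx)\<close> contains both \<open>(N : x)\<close> and \<open>a\<close>, and maximality
  makes the two colon ideals equal. It is an associated prime of \<open>M/N\<close>.\<close>

lemma (in module) ex_primeideal_colon:
  assumes noeth: "noetherian_ring R" and N: "submodule N R M" and ne: "N \<noteq> carrier M"
  obtains x where "x \<in> carrier M - N" and "primeideal (colon R M N x) R"
proof -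
  let ?Q = "colon R M N ` (carrier M - N)"
  obtain y where "y \<in> carrier M - N"
    using ne submoduleE(1)[OF N] by blast
  then have "colon R M N y \<in> ?Q" by blast
  then obtain I where I: "I \<in> ?Q"
    and max: "\<And>J. (J, I) \<in> {(J, I). ideal I R \<and> ideal J R \<and> I \<subset> J} \<Longrightarrow> J \<notin> ?Q"
    by (rule wfE_min[OF noetherian_ring.wf_ideals[OF noeth], of _ ?Q]) blast
  obtain x where x: "x \<in> carrier M" "x \<notin> N" and Ix: "I = colon R M N x"
    using I by blast
  have idI: "ideal I R" using ideal_colon[OF N x(1)] Ix by simp
  have "primeideal I R"
  proof (rule primeidealI[OF idI])
    show "cring R" by (rule R.is_cring)
    have "\<one> \<notin> I" using x by (simp add: Ix colon_def)
    then show "carrier R \<noteq> I" using R.one_closed by blast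
    fix a b assume ab: "a \<in> carrier R" "b \<in> carrier R" "a \<otimes> b \<in> I"
    show "a \<in> I \<or> b \<in> I"
    proof (rule disjCI)
      assume b: "b \<notin> I"
      let ?J = "colon R M N (b \<odot>\<^bsub>M\<^esub> x)"
      have bx: "b \<odot>\<^bsub>M\<^esub> x \<in> carrier M - N"
        using b ab x by (simp add: Ix colon_def)
      then have J: "ideal ?J R" "?J \<in> ?Q"
        using ideal_colon[OF N] by blast+
      have "I \<subseteq> ?J"
        using submoduleE(4)[OF N] x ab by (auto simp: Ix colon_def smult_left_commute[of _ b])
      then have "?J = I" using max[of ?J] idI J by blast
      moreover have "a \<in> ?J"
        using ab x by (simp add: Ix colon_def smult_assoc1)
      ultimately show "a \<in> I" by simp
    qed
  qed
  with x Ix show thesis using that[of x] by blast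
qed

text \<open>These stand for the submodules of \<open>M/N\<close>, so that no quotient module has to
  be formed.\<close>

definition submodules_above :: "('a, 'm) ring_scheme \<Rightarrow> ('a, 'b, 'n) module_scheme \<Rightarrow> 'b set \<Rightarrow> 'b set set"
  where "submodules_above R M N = {A. submodule A R M \<and> N \<subseteq> A}"

text \<open>Noetherian induction on \<open>N\<close>: for \<open>(N : x)\<close> prime, a submodule \<open>A\<close> above \<open>N\<close> is determined, among
  those comparable to it, by \<open>A + Rx\<close> and \<open>(A : x)\<close>.\<close>

lemma (in module) omega_graded_above:
  assumes noeth: "noetherian_ring R"
    and wf: "wf {(B, A). submodule A R M \<and> submodule B R M \<and> A \<subset> B}"
    and N: "submodule N R M"
    and graded: "\<And>L x. \<lbrakk>submodule L R M; N \<subseteq> L; x \<in> carrier M; primeideal (colon R M L x) R\<rbrakk>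
      \<Longrightarrow> omega_graded d {I. ideal I R \<and> colon R M L x \<subseteq> I}"
  shows "omega_graded d (submodules_above R M N)"
  using wf N graded
proof (induction N rule: wf_induct_rule)
  case (less N)
  show ?case
  proof (cases "N = carrier M")
    case True
    then have "submodules_above R M N \<subseteq> {carrier M}"
      using submoduleE(1) by (auto simp: submodules_above_def)
    then show ?thesis
      by (intro omega_gradedI[where f = "\<lambda>_. replicate d 0"]) auto
  next
    case False
    then obtain x where x: "x \<in> carrier M" "x \<notin> N" and prime: "primeideal (colon R M N x) R"
      using ex_primeideal_colon[OF noeth less.prems(1)] by blast
    let ?X = "smult_image M (carrier R) x"
    have X: "submodule ?X R M"
      using submodule_smult_image[OF R.oneideal x(1)] .
    let ?L = "N <+>\<^bsub>M\<^esub> ?X"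
    have L: "submodule ?L R M" "N \<subset> ?L"
      using submodule_add[OF less.prems(1) X] set_add_upper[OF less.prems(1) X]
        mem_smult_image_carrier[OF x(1)] x(2) by auto
    have Lgr: "omega_graded d (submodules_above R M ?L)"
      using less.IH[of ?L] less.prems L by blast
    have q: "omega_graded d {I. ideal I R \<and> colon R M N x \<subseteq> I}"
      using less.prems x prime by blast
    show ?thesis
    proof (rule omega_graded_prod[OF Lgr q, where g = "\<lambda>A. A <+>\<^bsub>M\<^esub> ?X" and h = "\<lambda>A. colon R M A x"])
      fix A assume A: "A \<in> submodules_above R M N"
      then show "A <+>\<^bsub>M\<^esub> ?X \<in> submodules_above R M ?L"
        using submodule_add[OF _ X] by (auto simp: submodules_above_def set_add_def')
      show "colon R M A x \<in> {I. ideal I R \<and> colon R M N x \<subseteq> I}"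
        using A ideal_colon[of A x] x(1) by (auto simp: submodules_above_def colon_def)
    next
      fix A B assume "A \<in> submodules_above R M N" "B \<in> submodules_above R M N" "A \<subseteq> B"
      then show "A <+>\<^bsub>M\<^esub> ?X \<subseteq> B <+>\<^bsub>M\<^esub> ?X \<and> colon R M A x \<subseteq> colon R M B x"
        by (auto simp: colon_def set_add_def')
    next
      fix A B assume A: "A \<in> submodules_above R M N" and B: "B \<in> submodules_above R M N"
        and sub: "A \<subseteq> B" and sum: "A <+>\<^bsub>M\<^esub> ?X = B <+>\<^bsub>M\<^esub> ?X" and col: "colon R M A x = colon R M B x"
      show "A = B"
      proof (rule submodule_modular[OF _ _ X sub])
        show "submodule A R M" "submodule B R M"
          using A B by (auto simp: submodules_above_def)
        then show "B \<subseteq> A <+>\<^bsub>M\<^esub> ?X"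
          using set_add_upper(1)[OF _ X] sum by blast
        \<comment> \<open>An element \<open>r x\<close> of \<open>B\<close> has
          \<open>r \<in> (B : x) = (A : x)\<close>, so it lies in \<open>A\<close>.\<close>
        show "B \<inter> ?X \<subseteq> A"
          using col by (auto simp: smult_image_def colon_def)
      qed
    qed
  qed
qed

section \<open>The ring as a module over itself, which turns ideals into submodules\<close>

definition regular_module :: "('a, 'm) ring_scheme \<Rightarrow> ('a, 'a) module" where
  "regular_module R = \<lparr>carrier = carrier R, monoid.mult = monoid.mult R, one = \<one>\<^bsub>R\<^esub>,
     ring.zero = \<zero>\<^bsub>R\<^esub>, ring.add = ring.add R, smult = monoid.mult R\<rparr>"

lemma regular_module_simps [simp]:
  "carrier (regular_module R) = carrier R"
  "\<zero>\<^bsub>regular_module R\<^esub> = \<zero>\<^bsub>R\<^esub>"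
  "x \<oplus>\<^bsub>regular_module R\<^esub> y = x \<oplus>\<^bsub>R\<^esub> y"
  "x \<odot>\<^bsub>regular_module R\<^esub> y = x \<otimes>\<^bsub>R\<^esub> y"
  by (simp_all add: regular_module_def)

lemma (in cring) module_regular_module: "module R (regular_module R)"
proof (rule moduleI)
  show "abelian_group (regular_module R)"
  proof (rule abelian_groupI)
    show "\<exists>y\<in>carrier (regular_module R). y \<oplus>\<^bsub>regular_module R\<^esub> x = \<zero>\<^bsub>regular_module R\<^esub>"
      if "x \<in> carrier (regular_module R)" for x
      using that l_neg by auto
  qed (simp_all add: a_ac)
qed (simp_all add: is_cring l_distr r_distr m_assoc)

lemma (in cring) submodule_regular_module:
  "submodule I R (regular_module R) \<longleftrightarrow> ideal I R"
proof
  interpret reg: module R "regular_module R" by (rule module_regular_module)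
  assume I: "submodule I R (regular_module R)"
  show "ideal I R"
    using reg.submoduleE(1,4,5)[OF I] reg.submodule_zero[OF I] by (intro idealI_closed) auto
next
  interpret reg: module R "regular_module R" by (rule module_regular_module)
  assume "ideal I R"
  then interpret ideal I R .
  show "submodule I R (regular_module R)"
    by (rule reg.submoduleI_closed) (auto simp: a_closed I_l_closed Icarr)
qed

text \<open>For a prime \<open>p\<close> this says that \<open>dim (R/p)\<close> is at least
  \<open>n\<close>. The recursion removes the lowest prime above \<open>p\<close>, which suits
  inductions on the dimension.\<close>

primrec prime_chain_above :: "('a, 'm) ring_scheme \<Rightarrow> nat \<Rightarrow> 'a set \<Rightarrow> bool" where
  "prime_chain_above R 0 p \<longleftrightarrow> True"
| "prime_chain_above R (Suc n) p \<longleftrightarrow> (\<exists>q. primeideal q R \<and> p \<subset> q \<and> prime_chain_above R n q)"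

lemma prime_chain_above_imp_chain:
  assumes "prime_chain_above R n p"
  shows "\<exists>C. C \<subseteq> {q. primeideal q R \<and> p \<subset> q} \<and> chain\<^sub>\<subseteq> C \<and> finite C \<and> card C = n"
  using assms
proof (induction n arbitrary: p)
  case 0
  then show ?case by (intro exI[of _ "{}"]) (auto simp: chain_subset_def)
next
  case (Suc n)
  then obtain q where q: "primeideal q R" "p \<subset> q" "prime_chain_above R n q" by auto
  then obtain C where C: "C \<subseteq> {r. primeideal r R \<and> q \<subset> r}" "chain\<^sub>\<subseteq> C" "finite C" "card C = n"
    using Suc.IH by blast
  have "insert q C \<subseteq> {r. primeideal r R \<and> p \<subset> r}" using q C(1) by blast
  moreover have "chain\<^sub>\<subseteq> (insert q C)" using C(1,2) by (auto simp: chain_subset_def)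
  moreover have "q \<notin> C" using C(1) by blast
  ultimately show ?case using C(3,4) by (intro exI[of _ "insert q C"]) simp
qed

lemma finite_krull_dim_bound:
  assumes "finite_krull_dim R" and p: "primeideal p R"
  obtains d where "prime_chain_above R d p" and "\<not> prime_chain_above R (Suc d) p"
proof -
  obtain D where D: "\<And>C. C \<subseteq> {p. primeideal p R} \<Longrightarrow> chain\<^sub>\<subseteq> C \<Longrightarrow> card C \<le> Suc D"
    using assms(1) unfolding finite_krull_dim_def by blast
  have bound: "n \<le> D" if n: "prime_chain_above R n p" for n
  proof -
    obtain C where C: "C \<subseteq> {q. primeideal q R \<and> p \<subset> q}" "chain\<^sub>\<subseteq> C" "finite C" "card C = n"
      using prime_chain_above_imp_chain[OF n] by blast
    have "p \<notin> C" using C(1) by blast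
    \<comment> \<open>The \<open>n\<close> primes above \<open>p\<close> together with
      \<open>p\<close> form a chain of \<open>n + 1\<close> primes.\<close>
    moreover have "card (insert p C) \<le> Suc D"
      using C p by (intro D) (auto simp: chain_subset_def)
    ultimately show ?thesis using C by simp
  qed
  define d where "d = (GREATEST n. prime_chain_above R n p)"
  have "prime_chain_above R d p"
    unfolding d_def by (rule GreatestI_nat[of _ 0 D]) (use bound in auto)
  moreover have "\<not> prime_chain_above R (Suc d) p"
  proof
    assume "prime_chain_above R (Suc d) p"
    then have "Suc d \<le> d"
      unfolding d_def by (rule Greatest_le_nat[of _ _ D]) (use bound in auto)
    then show False by simp
  qed
  ultimately show thesis by (rule that)
qed

text \<open>The upper bound \<open>\<omega>\<^sup>d\<close> for \<open>len (R/p)\<close> when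
  \<open>dim (R/p)\<close> is at most \<open>d\<close>. Every colon prime \<open>q\<close> met above
  an ideal properly above \<open>p\<close> has smaller coheight; by induction the ideals properly
  above \<open>q\<close> are graded, and \<open>q\<close> itself costs one more coordinate.\<close>

lemma (in cring) omega_graded_ideals:
  assumes noeth: "noetherian_ring R" and "primeideal p R" and "\<not> prime_chain_above R (Suc d) p"
  shows "omega_graded d {I. ideal I R \<and> p \<subset> I}"
  using assms(2,3)
proof (induction d arbitrary: p)
  case (0 p)
  interpret reg: module R "regular_module R" by (rule module_regular_module)
  \<comment> \<open>Here \<open>p\<close> is maximal: a proper ideal \<open>I\<close> properly above
    \<open>p\<close> would lie in a colon prime, which would then be properly above
    \<open>p\<close>.\<close>
  have "carrier R \<subseteq> I" if I: "ideal I R" "p \<subset> I" for I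
  proof (rule ccontr)
    assume "\<not> carrier R \<subseteq> I"
    then have "I \<noteq> carrier (regular_module R)" by auto
    moreover have sub: "submodule I R (regular_module R)"
      using I submodule_regular_module by blast
    ultimately obtain x where x: "x \<in> carrier R"
      and q: "primeideal (colon R (regular_module R) I x) R"
      using reg.ex_primeideal_colon[OF noeth] by (metis DiffD1 regular_module_simps(1))
    have "I \<subseteq> colon R (regular_module R) I x"
      using x ideal.I_r_closed[OF I(1)] ideal.Icarr[OF I(1)] by (auto simp: colon_def)
    then show False using q I(2) 0 by auto
  qed
  then have "I = carrier R" if "ideal I R" "p \<subset> I" for I
    using that by (auto dest: ideal.Icarr)
  then show ?case
    by (intro omega_gradedI[where f = "\<lambda>_. []"]) (simp, blast)
next
  case (Suc d p)
  interpret reg: module R "regular_module R" by (rule module_regular_module)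
  show ?case
  \<comment> \<open>Above a fixed \<open>I\<close> the colon primes contain \<open>p\<close>
    properly, so the induction hypothesis applies to them; starting from \<open>p\<close> itself,
    \<open>p\<close> would be among them.\<close>
  proof (rule omega_graded_local)
    fix I assume "I \<in> {I. ideal I R \<and> p \<subset> I}"
    then have I: "ideal I R" "p \<subset> I" by auto
    have "omega_graded (Suc d) (submodules_above R (regular_module R) I)"
    proof (rule reg.omega_graded_above[OF noeth])
      show "wf {(B, A). submodule A R (regular_module R) \<and> submodule B R (regular_module R) \<and> A \<subset> B}"
        using noetherian_ring.wf_ideals[OF noeth] by (simp add: submodule_regular_module)
      show "submodule I R (regular_module R)" using I submodule_regular_module by blast
      fix L x assume L: "submodule L R (regular_module R)" "I \<subseteq> L"
        and x: "x \<in> carrier (regular_module R)"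
        and q: "primeideal (colon R (regular_module R) L x) R"
      have idL: "ideal L R" using L submodule_regular_module by blast
      have "L \<subseteq> colon R (regular_module R) L x"
        using x ideal.I_r_closed[OF idL] ideal.Icarr[OF idL] by (auto simp: colon_def)
      then have pq: "p \<subset> colon R (regular_module R) L x" using I L by blast
      then have "\<not> prime_chain_above R (Suc d) (colon R (regular_module R) L x)"
        using Suc.prems(2) q by auto
      then have "omega_graded d {J. ideal J R \<and> colon R (regular_module R) L x \<subset> J}"
        using Suc.IH q by blast
      then show "omega_graded (Suc d) {J. ideal J R \<and> colon R (regular_module R) L x \<subseteq> J}"
        using omega_graded_insert_least[of d "{J. ideal J R}"] by simp
    qed
    moreover have "{A \<in> {I. ideal I R \<and> p \<subset> I}. I \<subseteq> A} \<subseteq> submodules_above R (regular_module R) I"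
      by (auto simp: submodules_above_def submodule_regular_module)
    ultimately show "omega_graded (Suc d) {A \<in> {I. ideal I R \<and> p \<subset> I}. I \<subseteq> A}"
      by (rule omega_graded_subset)
  qed
qed

section \<open>Descending chains from chains of primes\<close>

text \<open>For \<open>p \<subseteq> I\<close>, the image of \<open>I/p\<close> under multiplication
  by \<open>a\<close> on \<open>R/p\<close>, pulled back to \<open>R\<close>.\<close>

definition prime_lift :: "('a, 'm) ring_scheme \<Rightarrow> 'a set \<Rightarrow> 'a \<Rightarrow> 'a set \<Rightarrow> 'a set" where
  "prime_lift R p a I = p <+>\<^bsub>R\<^esub> (\<lambda>h. a \<otimes>\<^bsub>R\<^esub> h) ` I"

lemma (in cring) ideal_prime_lift:
  assumes p: "ideal p R" and a: "a \<in> carrier R" and I: "ideal I R"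
  shows "ideal (prime_lift R p a I) R"
proof -
  have "ideal ((\<lambda>h. a \<otimes> h) ` I) R"
  proof (rule idealI_closed)
    interpret ideal I R by fact
    show "(\<lambda>h. a \<otimes> h) ` I \<subseteq> carrier R" using a Icarr by auto
    show "\<zero> \<in> (\<lambda>h. a \<otimes> h) ` I" using a by (force intro: image_eqI[of _ _ \<zero>])
    show "u \<oplus> v \<in> (\<lambda>h. a \<otimes> h) ` I" if "u \<in> (\<lambda>h. a \<otimes> h) ` I" "v \<in> (\<lambda>h. a \<otimes> h) ` I" for u v
      using that a Icarr by (auto simp: r_distr[symmetric] intro!: imageI a_closed)
    show "r \<otimes> u \<in> (\<lambda>h. a \<otimes> h) ` I" if "r \<in> carrier R" "u \<in> (\<lambda>h. a \<otimes> h) ` I" for r u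
      using that a Icarr by (auto simp: m_lcomm[of r] intro!: imageI I_l_closed)
  qed
  then show ?thesis unfolding prime_lift_def using add_ideals[OF p] by blast
qed

lemma (in cring) subset_prime_lift:
  assumes p: "ideal p R" and a: "a \<in> carrier R" and I: "ideal I R"
  shows "p \<subseteq> prime_lift R p a I"
proof
  fix x assume x: "x \<in> p"
  have "x \<oplus> a \<otimes> \<zero> \<in> prime_lift R p a I"
    unfolding prime_lift_def using x additive_subgroup.zero_closed[OF ideal.axioms(1)[OF I]]
    by (intro set_addI) auto
  then show "x \<in> prime_lift R p a I" using a ideal.Icarr[OF p x] by simp
qed

text \<open>Multiplication by \<open>a\<close> is injective on the domain \<open>R/p\<close>: from
  \<open>a x = u + a h\<close> follows \<open>a (x - h) \<in> p\<close>, hence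
  \<open>x - h \<in> p \<subseteq> I\<close>.\<close>

lemma (in cring) mem_prime_lift_cancel:
  assumes p: "primeideal p R" and a: "a \<in> carrier R - p" and I: "ideal I R" "p \<subseteq> I"
    and x: "x \<in> carrier R" and ax: "a \<otimes> x \<in> prime_lift R p a I"
  shows "x \<in> I"
proof -
  interpret p: primeideal p R by fact
  interpret I: ideal I R by fact
  obtain u h where uh: "a \<otimes> x = u \<oplus> a \<otimes> h" "u \<in> p" "h \<in> I"
    using ax unfolding prime_lift_def by (elim set_addE) auto
  have mem: "u \<in> carrier R" "h \<in> carrier R" "a \<in> carrier R"
    using uh p.Icarr I.Icarr a by auto
  have "a \<otimes> (x \<ominus> h) = a \<otimes> x \<ominus> a \<otimes> h"
    using mem x by (simp add: minus_eq r_distr r_minus)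
  also have "\<dots> = u"
    using mem by (simp add: uh(1) minus_eq a_assoc r_neg)
  finally have "x \<ominus> h \<in> p"
    using p.I_prime[of a "x \<ominus> h"] uh(2) a x mem by auto
  then have "(x \<ominus> h) \<oplus> h \<in> I" using I uh(3) I.a_closed by blast
  then show ?thesis using x mem by (simp add: minus_eq a_assoc l_neg)
qed

lemma (in cring) prime_power_notin:
  assumes "primeideal p R" and "a \<in> carrier R - p"
  shows "a [^] (k::nat) \<in> carrier R - p"
proof (induction k)
  case 0
  then show ?case using assms(1) ideal.one_imp_carrier primeideal.I_notcarr primeideal.axioms(1)
    by fastforce
next
  case (Suc k)
  then show ?case using primeideal.I_prime[OF assms(1), of "a [^] k" a] assms(2) by auto
qed

text \<open>For a single step \<open>p \<subset> q\<close> and \<open>a \<in> q - p\<close>, the ideals \<open>p + a\<^sup>k I\<close> with \<open>q \<subset> I\<close> descend in \<open>k\<close>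
  because \<open>p + a\<^sup>k\<^sup>+\<^sup>1 R \<subseteq> p + a\<^sup>k q\<close>.\<close>

lemma (in cring) ex_descending_ideals:
  assumes "primeideal p R" and "prime_chain_above R d p"
  shows "\<exists>G. (\<forall>xs. length xs = d \<longrightarrow> ideal (G xs) R \<and> p \<subset> G xs) \<and>
    (\<forall>xs ys. length xs = d \<and> length ys = d \<and> lexless xs ys \<longrightarrow> G ys \<subset> G xs)"
  using assms
proof (induction d arbitrary: p)
  case (0 p)
  have "p \<subset> carrier R"
    using primeideal.I_notcarr[OF 0(1)] ideal.Icarr[OF primeideal.axioms(1)[OF 0(1)]] by blast
  then show ?case using oneideal by (intro exI[of _ "\<lambda>_. carrier R"]) auto
next
  case (Suc d p)
  then obtain q where q: "primeideal q R" "p \<subset> q" "prime_chain_above R d q" by auto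
  then obtain H where H: "\<forall>xs. length xs = d \<longrightarrow> ideal (H xs) R \<and> q \<subset> H xs"
    and Hless: "\<forall>xs ys. length xs = d \<and> length ys = d \<and> lexless xs ys \<longrightarrow> H ys \<subset> H xs"
    using Suc.IH[OF q(1,3)] by blast
  obtain a where aq: "a \<in> q" and "a \<notin> p" using q by blast
  interpret p: primeideal p R by fact
  interpret q: primeideal q R by fact
  have a: "a \<in> carrier R - p" using \<open>a \<notin> p\<close> aq q.Icarr by blast
  define E where "E k I = prime_lift R p (a [^] k) I" for k :: nat and I
  have ak: "a [^] k \<in> carrier R - p" for k :: nat
    using prime_power_notin[OF Suc.prems(1) a] .
  have idE: "ideal (E k I) R" if "ideal I R" for k I
    unfolding E_def using ideal_prime_lift[OF p.is_ideal _ that] ak by blast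
  have strict: "E k I \<subset> E k J" if I: "ideal I R" "q \<subseteq> I" and J: "ideal J R" "I \<subset> J" for k I J
  proof -
    obtain x where x: "x \<in> J" "x \<notin> I" using J by blast
    have xc: "x \<in> carrier R" using x J ideal.Icarr by metis
    have "\<zero> \<oplus> a [^] k \<otimes> x \<in> E k J"
      unfolding E_def prime_lift_def using x p.zero_closed by (intro set_addI) auto
    then have "a [^] k \<otimes> x \<in> E k J" using xc ak by simp
    moreover have "a [^] k \<otimes> x \<notin> E k I"
      using mem_prime_lift_cancel[OF Suc.prems(1) ak I(1) _ xc] I q(2) x(2) unfolding E_def by blast
    moreover have "E k I \<subseteq> E k J"
      using J(2) unfolding E_def prime_lift_def set_add_def' by blast
    ultimately show ?thesis by blast
  qed
  \<comment> \<open>For \<open>l = k + j + 1\<close> one has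
    \<open>a\<^sup>l h = a\<^sup>k (a\<^sup>j h a)\<close>, and the spare factor \<open>a\<close>
    lies in \<open>q\<close>. So every ideal with exponent \<open>l\<close> lies in
    \<open>E k q\<close>, which by \<open>strict\<close> is properly below all members with exponent
    \<open>k\<close>.\<close>
  have step: "E l J \<subseteq> E k q" if kl: "k < l" and J: "ideal J R" for k l J
  proof
    fix y assume "y \<in> E l J"
    then obtain u h where y: "y = u \<oplus> a [^] l \<otimes> h" "u \<in> p" "h \<in> J"
      unfolding E_def prime_lift_def by (elim set_addE) auto
    obtain j where l: "l = k + Suc j" using kl less_iff_Suc_add by auto
    have hc: "h \<in> carrier R" using y J ideal.Icarr by metis
    have "a [^] l \<otimes> h = a [^] k \<otimes> ((a [^] j \<otimes> h) \<otimes> a)"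
      using a hc by (simp add: l nat_pow_mult[symmetric] m_ac)
    moreover have "(a [^] j \<otimes> h) \<otimes> a \<in> q"
      using aq a hc q.I_l_closed by auto
    ultimately show "y \<in> E k q"
      unfolding y(1) E_def prime_lift_def using y(2) by (intro set_addI) auto
  qed
  have top: "p \<subset> E k I" if I: "ideal I R" "q \<subset> I" for k I
  proof -
    have "p \<subseteq> E k q"
      unfolding E_def using subset_prime_lift[OF p.is_ideal _ q.is_ideal] ak by blast
    then show ?thesis using strict[OF q.is_ideal order_refl I] by blast
  qed
  \<comment> \<open>The leading entry is the exponent of \<open>a\<close>; the remaining entries
    index the chain above \<open>q\<close>.\<close>
  let ?G = "\<lambda>xs. E (hd xs) (H (tl xs))"
  show ?case
  proof (intro exI[of _ ?G] conjI allI impI)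
    fix xs :: "nat list" assume "length xs = Suc d"
    then have "ideal (H (tl xs)) R \<and> q \<subset> H (tl xs)" using H by simp
    then show "ideal (?G xs) R" "p \<subset> ?G xs" using idE top by blast+
  next
    fix xs ys :: "nat list" assume xy: "length xs = Suc d \<and> length ys = Suc d \<and> lexless xs ys"
    then obtain k us l vs where eq: "xs = k # us" "ys = l # vs" "length us = d" "length vs = d"
      by (auto simp: length_Suc_conv)
    have Hus: "ideal (H us) R" "q \<subset> H us" and Hvs: "ideal (H vs) R" "q \<subset> H vs"
      using H eq by auto
    consider "k < l" | "k = l" "lexless us vs" using xy eq by auto
    then show "?G ys \<subset> ?G xs"
    proof cases
      case 1
      then show ?thesis
        using step[OF 1 Hvs(1)] strict[OF q.is_ideal order_refl Hus, of k] by (simp add: eq psubset_trans subset_psubset_trans)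
    next
      case 2
      then show ?thesis
        using strict[OF Hvs(1) _ Hus(1)] Hvs(2) Hless eq by auto
    qed
  qed
qed

text \<open>The descending ideals above \<open>(N : x)\<close> are carried over to \<open>M\<close>
  by sending \<open>I\<close> to \<open>N + I x\<close>, since \<open>(N + Rx)/N\<close> is a copy
  of \<open>R/(N : x)\<close>.\<close>

lemma (in module) ex_descending_submodules:
  assumes N: "submodule N R M" and x: "x \<in> carrier M"
    and prime: "primeideal (colon R M N x) R" and "prime_chain_above R d (colon R M N x)"
  obtains G where "\<And>xs. length xs = d \<Longrightarrow> submodule (G xs) R M \<and> N \<subset> G xs"
    and "\<And>xs ys. \<lbrakk>length xs = d; length ys = d; lexless xs ys\<rbrakk> \<Longrightarrow> G ys \<subset> G xs"
proof -
  let ?q = "colon R M N x"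
  obtain H where H: "\<forall>xs. length xs = d \<longrightarrow> ideal (H xs) R \<and> ?q \<subset> H xs"
    and Hless: "\<forall>xs ys. length xs = d \<and> length ys = d \<and> lexless xs ys \<longrightarrow> H ys \<subset> H xs"
    using R.ex_descending_ideals[OF prime assms(4)] by blast
  let ?S = "\<lambda>I. N <+>\<^bsub>M\<^esub> smult_image M I x"
  have mem: "r \<odot>\<^bsub>M\<^esub> x \<in> ?S I" if "r \<in> I" "ideal I R" for r I
  proof -
    have "\<zero>\<^bsub>M\<^esub> \<oplus>\<^bsub>M\<^esub> r \<odot>\<^bsub>M\<^esub> x \<in> ?S I"
      using submodule_zero[OF N] that(1) by (intro set_addI) (auto simp: smult_image_def)
    then show ?thesis using x ideal.Icarr[OF that(2,1)] by simp
  qed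
  \<comment> \<open>If \<open>r x = n + h x\<close>, then
    \<open>r - h \<in> (N : x) \<subseteq> I\<close>; this keeps the inclusions strict.\<close>
  have cancel: "r \<in> I" if I: "ideal I R" "?q \<subseteq> I" and r: "r \<in> carrier R" "r \<odot>\<^bsub>M\<^esub> x \<in> ?S I" for r I
  proof -
    obtain n h where nh: "r \<odot>\<^bsub>M\<^esub> x = n \<oplus>\<^bsub>M\<^esub> h \<odot>\<^bsub>M\<^esub> x" "n \<in> N" "h \<in> I"
      using r(2) by (elim set_addE) (auto simp: smult_image_def)
    have c: "n \<in> carrier M" "h \<in> carrier R"
      using nh submoduleE(1)[OF N] ideal.Icarr[OF I(1)] by auto
    have "(r \<ominus> h) \<odot>\<^bsub>M\<^esub> x = n"
      using c x r(1) by (simp add: smult_minus_distr nh(1) M.minus_eq M.a_assoc M.r_neg)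
    then have "r \<ominus> h \<in> I" using nh(2) I(2) r(1) c by (auto simp: colon_def)
    then have "(r \<ominus> h) \<oplus> h \<in> I"
      using nh(3) additive_subgroup.a_closed[OF ideal.axioms(1)[OF I(1)]] by blast
    then show ?thesis using r(1) c by (simp add: R.minus_eq R.a_assoc R.l_neg)
  qed
  have above: "submodule (?S I) R M \<and> N \<subset> ?S I" if I: "ideal I R" "?q \<subset> I" for I
  proof -
    obtain r where r: "r \<in> I" "r \<notin> ?q" using I by blast
    then have "r \<odot>\<^bsub>M\<^esub> x \<notin> N" using ideal.Icarr[OF I(1)] by (auto simp: colon_def)
    then show ?thesis
      using mem[OF r(1) I(1)] submodule_add[OF N submodule_smult_image[OF I(1) x]]
        set_add_upper(1)[OF N submodule_smult_image[OF I(1) x]] by blast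
  qed
  have strict: "?S I \<subset> ?S J" if I: "ideal I R" "?q \<subseteq> I" and J: "ideal J R" "I \<subset> J" for I J
  proof -
    obtain r where r: "r \<in> J" "r \<notin> I" using J by blast
    have "r \<odot>\<^bsub>M\<^esub> x \<notin> ?S I" using cancel[OF I] r ideal.Icarr[OF J(1)] by blast
    moreover have "?S I \<subseteq> ?S J"
      using J(2) by (auto simp: set_add_def' smult_image_def)
    ultimately show ?thesis using mem[OF r(1) J(1)] by blast
  qed
  show thesis
  proof (rule that[of "\<lambda>xs. ?S (H xs)"])
    show "submodule (?S (H xs)) R M \<and> N \<subset> ?S (H xs)" if "length xs = d" for xs
      using above H that by blast
    show "?S (H ys) \<subset> ?S (H xs)" if "length xs = d" "length ys = d" "lexless xs ys" for xs ys
    proof (rule strict)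
      show "ideal (H ys) R" "?q \<subseteq> H ys" "ideal (H xs) R" using H that by auto
      show "H ys \<subset> H xs" using Hless that by blast
    qed
  qed
qed

section \<open>Modules of length \<open>\<omega>\<^sup>d\<close>\<close>

lemma has_olen_chain:
  assumes "has_olen R M r" and "C \<subseteq> nonzero_submodules R M" and "chain\<^sub>\<subseteq> C"
  shows "rev_incl C \<le>o r"
  using assms unfolding has_olen_def is_osup_def by blast

text \<open>A grading that includes the zero submodule gives it a value \<open>b\<close> below
  \<open>\<omega>\<^sup>d\<close>, and all nonzero submodules get smaller values. Then
  \<open>b\<close> bounds every chain, so the supremum is below
  \<open>\<omega>\<^sup>d\<close>.\<close>

lemma (in module) not_omega_graded_submodules:
  assumes len: "has_olen R M (omega_pow d)"
  shows "\<not> omega_graded d {A. submodule A R M}"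
proof
  assume "omega_graded d {A. submodule A R M}"
  then obtain f where f: "\<forall>A\<in>{A. submodule A R M}. length (f A) = d"
    "\<forall>A\<in>{A. submodule A R M}. \<forall>B\<in>{A. submodule A R M}. A \<subset> B \<longrightarrow> lexless (f B) (f A)"
    unfolding omega_graded_def by blast
  define b where "b = f {\<zero>\<^bsub>M\<^esub>}"
  have b: "length b = d" using f(1) submodule_singleton_zero by (simp add: b_def)
  \<comment> \<open>\<open>t\<close> is the ordinal \<open>b\<close>, realized on the same type as
    \<open>omega_pow d\<close> so that it competes as an upper bound in
    \<open>is_osup\<close>.\<close>
  define t where "t = Restr (omega_pow d) {xs. lexless xs b}"
  have t: "Well_order t"
    unfolding t_def using Well_order_Restr Well_order_omega_pow by blast
  have Field_t: "Field t = {xs. length xs = d \<and> lexless xs b}"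
    unfolding t_def by (auto simp: Field_def omega_pow_def dest: lexn_length)
  have t_less: "t - Id = {(xs, ys). length xs = d \<and> length ys = d \<and> lexless xs ys \<and> lexless xs b \<and> lexless ys b}"
    unfolding t_def using omega_pow_minus_Id[of d] by blast
  have "rev_incl C \<le>o t" if C: "C \<subseteq> nonzero_submodules R M" "chain\<^sub>\<subseteq> C" for C
  proof (rule rev_incl_ordLeq[OF t C(2)])
    show fC: "f A \<in> Field t" if "A \<in> C" for A
    proof -
      have A: "submodule A R M" "A \<noteq> {\<zero>\<^bsub>M\<^esub>}"
        using that C(1) by (auto simp: nonzero_submodules_def)
      then have "{\<zero>\<^bsub>M\<^esub>} \<subset> A" using submodule_zero by blast
      then show ?thesis
        using f A(1) submodule_singleton_zero by (auto simp: Field_t b_def)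
    qed
    show "(f B, f A) \<in> t - Id" if "A \<in> C" "B \<in> C" "A \<subset> B" for A B
    proof -
      have "submodule A R M" "submodule B R M"
        using that C(1) by (auto simp: nonzero_submodules_def)
      then have "lexless (f B) (f A)" using f(2) that(3) by blast
      then show ?thesis using fC[OF that(1)] fC[OF that(2)] by (simp add: t_less Field_t)
    qed
  qed
  then have "omega_pow d \<le>o t"
    using len t unfolding has_olen_def is_osup_def by blast
  then obtain g where g: "\<And>xs. length xs = d \<Longrightarrow> length (g xs) = d \<and> lexless (g xs) b"
    and "\<And>xs ys. \<lbrakk>length xs = d; length ys = d; lexless xs ys\<rbrakk> \<Longrightarrow> lexless (g xs) (g ys)"
    by (rule ordLeq_imp_strict_mono) (simp add: Field_t t_less Field_omega_pow omega_pow_minus_Id, blast)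
  then have "\<not> lexless (g b) b" using b by (intro omega_pow_self_map) auto
  then show False using g b by blast
qed

text \<open>The ascending chain condition comes from the length: \<open>\<le>o\<close> holds only
  between well-orders, so no chain of nonzero submodules ascends forever.\<close>

lemma (in module) wf_submodules:
  assumes len: "has_olen R M r"
  shows "wf {(B, A). submodule A R M \<and> submodule B R M \<and> A \<subset> B}"
proof -
  have "wf {(B, A). A \<in> {A. submodule A R M} \<and> B \<in> {A. submodule A R M} \<and> A \<subset> B}"
  proof (rule wf_if_no_ascending)
    fix f assume f: "\<And>i. f i \<in> {A. submodule A R M}" "\<And>i. f i \<subset> f (Suc i)"
    \<comment> \<open>The shift drops \<open>f 0\<close>, the only term that can be zero.\<close>
    let ?g = "\<lambda>i. f (Suc i)"
    have mono: "?g i \<subseteq> ?g j" if "i \<le> j" for i j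
      using lift_Suc_mono_le[of f] f(2) that by blast
    have "?g i \<noteq> {\<zero>\<^bsub>M\<^esub>}" for i
      using f(2)[of i] f(1)[of i] submodule_zero[of "f i"] by auto
    then have "range ?g \<subseteq> nonzero_submodules R M"
      using f(1) by (auto simp: nonzero_submodules_def)
    moreover have "chain\<^sub>\<subseteq> (range ?g)"
    proof -
      have "?g i \<subseteq> ?g j \<or> ?g j \<subseteq> ?g i" for i j
        using mono nat_le_linear by metis
      then show ?thesis by (simp add: chain_subset_def)
    qed
    ultimately have "rev_incl (range ?g) \<le>o r"
      by (rule has_olen_chain[OF len])
    then have "wf (rev_incl (range ?g) - Id)"
      using ordLeq_Well_order_simp by (metis well_order_on_def)
    moreover have "(?g (Suc i), ?g i) \<in> rev_incl (range ?g) - Id" for i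
      using f(2) unfolding rev_incl_minus_Id by blast
    ultimately show False using wf_no_infinite_down_chainE[of _ ?g] by metis
  qed
  then show ?thesis by simp
qed

text \<open>The family contains \<open>N\<close> itself, the zero of \<open>M/N\<close>, so a
  grading by \<open>d\<close>-tuples expresses the strict bound
  \<open>len (M/N) < \<omega>\<^sup>d\<close>.\<close>

lemma (in module) omega_graded_above_nonzero:
  assumes noeth: "noetherian_ring R" and len: "has_olen R M (omega_pow d)"
    and N: "submodule N R M" "N \<noteq> {\<zero>\<^bsub>M\<^esub>}"
  shows "omega_graded d (submodules_above R M N)"
proof (rule omega_graded_above[OF noeth wf_submodules[OF len] N(1)])
  fix L x assume L: "submodule L R M" "N \<subseteq> L" and x: "x \<in> carrier M"
    and prime: "primeideal (colon R M L x) R"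
  have "\<not> prime_chain_above R d (colon R M L x)"
  proof
    assume "prime_chain_above R d (colon R M L x)"
    then obtain G where G: "\<And>xs. length xs = d \<Longrightarrow> submodule (G xs) R M \<and> L \<subset> G xs"
      and anti: "\<And>xs ys. \<lbrakk>length xs = d; length ys = d; lexless xs ys\<rbrakk> \<Longrightarrow> G ys \<subset> G xs"
      by (rule ex_descending_submodules[OF L(1) x prime]) blast
    let ?C = "insert L (G ` {xs. length xs = d})"
    have "N \<subset> G xs" if "length xs = d" for xs using G that L(2) by blast
    then have "?C \<subseteq> nonzero_submodules R M"
      using G L N submodule_zero[OF N(1)] unfolding nonzero_submodules_def by blast
    moreover have "chain\<^sub>\<subseteq> ?C"
      using chain_subset_antitone_range[of d G, OF anti] G unfolding chain_subset_def by blast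
    ultimately have "rev_incl ?C \<le>o omega_pow d"
      by (rule has_olen_chain[OF len])
    moreover have "\<not> rev_incl ?C \<le>o omega_pow d"
      using G anti by (intro not_rev_incl_ordLeq_omega_pow) auto
    ultimately show False by blast
  qed
  \<comment> \<open>\<open>d\<close> is positive, because a chain of zero primes above the colon
    prime always exists; the coordinate saved here pays for the colon prime itself.\<close>
  then obtain e where e: "d = Suc e" "\<not> prime_chain_above R (Suc e) (colon R M L x)"
    by (cases d) auto
  have "omega_graded e {J. ideal J R \<and> colon R M L x \<subset> J}"
    using R.omega_graded_ideals[OF noeth prime e(2)] .
  then show "omega_graded d {J. ideal J R \<and> colon R M L x \<subseteq> J}"
    using omega_graded_insert_least[of e "{J. ideal J R}"] e(1) by simp
qed

text \<open>Otherwise \<open>len M\<close> would be at most the natural sum of \<open>len (M/N)\<close> and \<open>len (M/K)\<close>, both of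
  which are below \<open>\<omega>\<^sup>d\<close>.\<close>

lemma (in module) no_univalent_splitting:
  assumes noeth: "noetherian_ring R" and len: "has_olen R M (omega_pow d)"
    and N: "submodule N R M" "N \<noteq> {\<zero>\<^bsub>M\<^esub>}" and K: "submodule K R M" "K \<noteq> {\<zero>\<^bsub>M\<^esub>}"
    and g: "\<And>A. submodule A R M \<Longrightarrow> submodule (g A) R M \<and> K \<subseteq> g A"
    and mono: "\<And>A B. \<lbrakk>submodule A R M; submodule B R M; A \<subseteq> B\<rbrakk> \<Longrightarrow> g A \<subseteq> g B"
    and inj: "\<And>A B. \<lbrakk>submodule A R M; submodule B R M; A \<subseteq> B; g A = g B\<rbrakk> \<Longrightarrow> B \<inter> N \<subseteq> A"
  shows False
proof -
  \<comment> \<open>\<open>A + N\<close> records the image of \<open>A\<close> in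
    \<open>M/N\<close>, and \<open>g A\<close> controls its intersection with \<open>N\<close>; the
    modular law recovers \<open>A\<close> from both.\<close>
  have "omega_graded d {A. submodule A R M}"
  proof (rule omega_graded_prod[OF omega_graded_above_nonzero[OF noeth len N]
        omega_graded_above_nonzero[OF noeth len K], where g = "\<lambda>A. A <+>\<^bsub>M\<^esub> N" and h = g])
    fix A assume "A \<in> {A. submodule A R M}"
    then show "A <+>\<^bsub>M\<^esub> N \<in> submodules_above R M N" "g A \<in> submodules_above R M K"
      using submodule_add[OF _ N(1)] set_add_upper(2)[OF _ N(1)] g by (auto simp: submodules_above_def)
  next
    fix A B assume "A \<in> {A. submodule A R M}" "B \<in> {A. submodule A R M}" "A \<subseteq> B"
    then show "A <+>\<^bsub>M\<^esub> N \<subseteq> B <+>\<^bsub>M\<^esub> N \<and> g A \<subseteq> g B"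
      using mono by (auto simp: set_add_def')
  next
    fix A B assume "A \<in> {A. submodule A R M}" "B \<in> {A. submodule A R M}" and sub: "A \<subseteq> B"
      and eq: "A <+>\<^bsub>M\<^esub> N = B <+>\<^bsub>M\<^esub> N" "g A = g B"
    then have AB: "submodule A R M" "submodule B R M" by auto
    show "A = B"
      using set_add_upper(1)[OF AB(2) N(1)] eq inj[OF AB sub]
      by (intro submodule_modular[OF AB N(1) sub]) auto
  qed
  then show False using not_omega_graded_submodules[OF len] by blast
qed

text \<open>The image \<open>sM\<close> is isomorphic to \<open>M\<close> modulo the kernel of
  \<open>s\<close>. If both image and kernel were nonzero, the splitting with \<open>N = sM\<close>,
  \<open>K\<close> the kernel and \<open>g\<close> the preimage under \<open>s\<close> would be
  contradictory.\<close>

lemma (in module) univalent_smult_injective: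
  assumes noeth: "noetherian_ring R" and len: "has_olen R M (omega_pow d)"
    and s: "s \<in> carrier R" and y: "y \<in> carrier M" "s \<odot>\<^bsub>M\<^esub> y \<noteq> \<zero>\<^bsub>M\<^esub>"
    and m: "m \<in> carrier M" "s \<odot>\<^bsub>M\<^esub> m = \<zero>\<^bsub>M\<^esub>"
  shows "m = \<zero>\<^bsub>M\<^esub>"
proof (rule ccontr)
  assume "m \<noteq> \<zero>\<^bsub>M\<^esub>"
  let ?g = "\<lambda>A. {m \<in> carrier M. s \<odot>\<^bsub>M\<^esub> m \<in> A}"
  show False
  proof (rule no_univalent_splitting[OF noeth len submodule_smult_range[OF s] _
        submodule_smult_vimage[OF submodule_singleton_zero s], where g = ?g])
    show "(\<lambda>m. s \<odot>\<^bsub>M\<^esub> m) ` carrier M \<noteq> {\<zero>\<^bsub>M\<^esub>}" using y by blast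
    show "?g {\<zero>\<^bsub>M\<^esub>} \<noteq> {\<zero>\<^bsub>M\<^esub>}" using m \<open>m \<noteq> \<zero>\<^bsub>M\<^esub>\<close> by blast
    show "submodule (?g A) R M \<and> ?g {\<zero>\<^bsub>M\<^esub>} \<subseteq> ?g A" if "submodule A R M" for A
      using submodule_smult_vimage[OF that s] submodule_zero[OF that] by auto
  qed auto
qed

text \<open>If \<open>Rx\<close> and \<open>Ry\<close> met only in zero, \<open>Rx\<close> would
  embed into \<open>M/Ry\<close>, and \<open>A \<inter> Rx\<close> could be recovered from
  \<open>(A \<inter> Rx) + Ry\<close>; this is a forbidden splitting with \<open>N = Rx\<close> and
  \<open>K = Ry\<close>.\<close>

lemma (in module) univalent_cyclic_Int:
  assumes noeth: "noetherian_ring R" and len: "has_olen R M (omega_pow d)"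
    and x: "x \<in> carrier M" "x \<noteq> \<zero>\<^bsub>M\<^esub>" and y: "y \<in> carrier M" "y \<noteq> \<zero>\<^bsub>M\<^esub>"
  shows "\<exists>a\<in>carrier R. \<exists>b\<in>carrier R. a \<odot>\<^bsub>M\<^esub> y = b \<odot>\<^bsub>M\<^esub> x \<and> a \<odot>\<^bsub>M\<^esub> y \<noteq> \<zero>\<^bsub>M\<^esub>"
proof (rule ccontr)
  assume contra: "\<not> ?thesis"
  let ?X = "smult_image M (carrier R) x" and ?Y = "smult_image M (carrier R) y"
  have X: "submodule ?X R M" and Y: "submodule ?Y R M"
    using submodule_smult_image[OF R.oneideal] x y by auto
  have int: "v = \<zero>\<^bsub>M\<^esub>" if "v \<in> ?X" "v \<in> ?Y" for v
    using contra that unfolding smult_image_def by (elim imageE) metis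
  show False
  proof (rule no_univalent_splitting[OF noeth len X _ Y, where g = "\<lambda>A. (A \<inter> ?X) <+>\<^bsub>M\<^esub> ?Y"])
    show "?X \<noteq> {\<zero>\<^bsub>M\<^esub>}" "?Y \<noteq> {\<zero>\<^bsub>M\<^esub>}"
      using mem_smult_image_carrier x y by blast+
    show "submodule (A \<inter> ?X <+>\<^bsub>M\<^esub> ?Y) R M \<and> ?Y \<subseteq> A \<inter> ?X <+>\<^bsub>M\<^esub> ?Y" if "submodule A R M" for A
      using submodule_Int[OF that X] submodule_add[OF _ Y] set_add_upper(2)[OF _ Y] by blast
    show "A \<inter> ?X <+>\<^bsub>M\<^esub> ?Y \<subseteq> B \<inter> ?X <+>\<^bsub>M\<^esub> ?Y" if "A \<subseteq> B" for A B
      using that by (auto simp: set_add_def')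
    fix A B assume A: "submodule A R M" and B: "submodule B R M"
      and eq: "A \<inter> ?X <+>\<^bsub>M\<^esub> ?Y = B \<inter> ?X <+>\<^bsub>M\<^esub> ?Y"
    show "B \<inter> ?X \<subseteq> A"
    proof
      fix b assume b: "b \<in> B \<inter> ?X"
      then have "b \<in> A \<inter> ?X <+>\<^bsub>M\<^esub> ?Y"
        using set_add_upper(1)[OF submodule_Int[OF B X] Y] eq by blast
      then obtain a v where av: "b = a \<oplus>\<^bsub>M\<^esub> v" "a \<in> A" "a \<in> ?X" "v \<in> ?Y"
        by (elim set_addE) auto
      have c: "a \<in> carrier M" "v \<in> carrier M"
        using av submoduleE(1)[OF X] submoduleE(1)[OF Y] by auto
      have "b \<ominus>\<^bsub>M\<^esub> a = v" using c by (simp add: av(1) M.minus_add_cancel')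
      then have "v \<in> ?X" using submodule_minus[OF X _ av(3), of b] b by auto
      then have "v = \<zero>\<^bsub>M\<^esub>" using int av(4) by blast
      then show "b \<in> A" using av(1,2) c by simp
    qed
  qed
qed

section \<open>Modules isomorphic to ideals of a residue domain\<close>

lemma (in ideal) FactRing_ops:
  "carrier (R Quot I) = (\<lambda>a. I +> a) ` carrier R"
  "\<zero>\<^bsub>R Quot I\<^esub> = I"
  "\<lbrakk>a \<in> carrier R; b \<in> carrier R\<rbrakk> \<Longrightarrow> (I +> a) \<oplus>\<^bsub>R Quot I\<^esub> (I +> b) = I +> (a \<oplus> b)"
  "\<lbrakk>a \<in> carrier R; b \<in> carrier R\<rbrakk> \<Longrightarrow> (I +> a) \<otimes>\<^bsub>R Quot I\<^esub> (I +> b) = I +> (a \<otimes> b)"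
  by (auto simp: FactRing_def A_RCOSETS_def' a_rcos_sum rcoset_mult_add)

lemma (in ideal) mem_coset_iff:
  "\<lbrakk>a \<in> carrier R; b \<in> carrier R\<rbrakk> \<Longrightarrow> b \<in> I +> a \<longleftrightarrow> b \<ominus> a \<in> I"
  using a_rcos_module_minus[OF ring_axioms] by blast

lemma (in ideal) coset_eq_self_iff:
  "a \<in> carrier R \<Longrightarrow> I +> a = I \<longleftrightarrow> a \<in> I"
  using a_rcos_const a_rcos_self by metis

lemma quot_ideal_module_simps:
  "carrier (quot_ideal_module R I J) = J"
  "A \<oplus>\<^bsub>quot_ideal_module R I J\<^esub> B = A \<oplus>\<^bsub>R Quot I\<^esub> B"
  "r \<odot>\<^bsub>quot_ideal_module R I J\<^esub> A = (I +>\<^bsub>R\<^esub> r) \<otimes>\<^bsub>R Quot I\<^esub> A"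
  by (simp_all add: quot_ideal_module_def)

text \<open>Even \<open>\<omega>\<^sup>0 = 1\<close> exceeds the length of the zero module, whose
  single submodule is graded by a constant.\<close>

lemma (in module) univalent_nonzero:
  assumes len: "has_olen R M (omega_pow d)"
  shows "carrier M \<noteq> {\<zero>\<^bsub>M\<^esub>}"
proof
  assume zero: "carrier M = {\<zero>\<^bsub>M\<^esub>}"
  have "A = {\<zero>\<^bsub>M\<^esub>}" if "submodule A R M" for A
    using submoduleE(1,2)[OF that] zero by (simp add: subset_singleton_iff)
  then have "omega_graded d {A. submodule A R M}"
    by (intro omega_gradedI[where f = "\<lambda>_. replicate d 0"]) auto
  then show False using not_omega_graded_submodules[OF len] by blast
qed

lemma (in module) annihilator_mem_iff:
  "r \<in> annihilator R M \<longleftrightarrow> r \<in> carrier R \<and> (\<forall>x\<in>carrier M. r \<odot>\<^bsub>M\<^esub> x = \<zero>\<^bsub>M\<^esub>)"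
  by (simp add: annihilator_def)

text \<open>If \<open>r\<close> kills one nonzero element, multiplication by \<open>r\<close> is not
  injective and hence zero. So every nonzero element has the same annihilator as \<open>M\<close>,
  and primality follows as for a domain.\<close>

lemma (in module) univalent_annihilator:
  assumes noeth: "noetherian_ring R" and len: "has_olen R M (omega_pow d)"
  shows "primeideal (annihilator R M) R"
    and "\<lbrakk>r \<in> carrier R; x \<in> carrier M; x \<noteq> \<zero>\<^bsub>M\<^esub>; r \<odot>\<^bsub>M\<^esub> x = \<zero>\<^bsub>M\<^esub>\<rbrakk> \<Longrightarrow> r \<in> annihilator R M"
proof -
  show torsionfree: "r \<in> annihilator R M"
    if "r \<in> carrier R" "x \<in> carrier M" "x \<noteq> \<zero>\<^bsub>M\<^esub>" "r \<odot>\<^bsub>M\<^esub> x = \<zero>\<^bsub>M\<^esub>" for r x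
    using univalent_smult_injective[OF noeth len that(1) _ _ that(2,4)] that
    unfolding annihilator_mem_iff by blast
  have "ideal (annihilator R M) R"
    by (rule R.idealI_closed) (auto simp: annihilator_mem_iff smult_l_distr smult_assoc1)
  then show "primeideal (annihilator R M) R"
  proof (rule primeidealI)
    obtain x where x: "x \<in> carrier M" "x \<noteq> \<zero>\<^bsub>M\<^esub>"
      using univalent_nonzero[OF len] M.zero_closed by blast
    then have "\<one> \<notin> annihilator R M" by (auto simp: annihilator_mem_iff)
    then show "carrier R \<noteq> annihilator R M" using R.one_closed by blast
    show "a \<in> annihilator R M \<or> b \<in> annihilator R M"
      if ab: "a \<in> carrier R" "b \<in> carrier R" "a \<otimes> b \<in> annihilator R M" for a b
    proof (cases "b \<odot>\<^bsub>M\<^esub> x = \<zero>\<^bsub>M\<^esub>")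
      case True
      then show ?thesis using torsionfree x ab by blast
    next
      case False
      have "a \<odot>\<^bsub>M\<^esub> (b \<odot>\<^bsub>M\<^esub> x) = \<zero>\<^bsub>M\<^esub>"
        using ab x by (simp add: annihilator_mem_iff smult_assoc1[symmetric])
      then show ?thesis using torsionfree[of a "b \<odot>\<^bsub>M\<^esub> x"] False ab x by blast
    qed
  qed (rule R.is_cring)
qed

text \<open>Since any two nonzero elements have a common nonzero multiple, clearing denominators in a finite
  generating set gives \<open>a \<noteq> 0\<close> with \<open>a M \<subseteq> R x\<close>.\<close>

lemma (in module) univalent_embedding:
  assumes noeth: "noetherian_ring R" and fg: "finitely_generated R M"
    and len: "has_olen R M (omega_pow d)" and x: "x \<in> carrier M" "x \<noteq> \<zero>\<^bsub>M\<^esub>"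
  obtains a where "a \<in> carrier R - annihilator R M"
    and "\<And>m. m \<in> carrier M \<Longrightarrow> \<exists>r\<in>carrier R. a \<odot>\<^bsub>M\<^esub> m = r \<odot>\<^bsub>M\<^esub> x"
proof -
  interpret p: primeideal "annihilator R M" R
    using univalent_annihilator(1)[OF noeth len] .
  have one: "\<one> \<in> carrier R - annihilator R M"
    using p.I_notcarr p.one_imp_carrier by auto
  let ?X = "smult_image M (carrier R) x"
  have X: "submodule ?X R M"
    using submodule_smult_image[OF R.oneideal x(1)] .
  have single: "\<exists>a\<in>carrier R - annihilator R M. a \<odot>\<^bsub>M\<^esub> y \<in> ?X" if y: "y \<in> carrier M" for y
  proof (cases "y = \<zero>\<^bsub>M\<^esub>")
    case True
    then show ?thesis using one submodule_zero[OF X] by (intro bexI[of _ \<one>]) auto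
  next
    case False
    then obtain a b where "a \<in> carrier R" "b \<in> carrier R" "a \<odot>\<^bsub>M\<^esub> y = b \<odot>\<^bsub>M\<^esub> x" "a \<odot>\<^bsub>M\<^esub> y \<noteq> \<zero>\<^bsub>M\<^esub>"
      using univalent_cyclic_Int[OF noeth len x y] by blast
    \<comment> \<open>\<open>a y \<noteq> 0\<close> keeps \<open>a\<close> outside the
      annihilator.\<close>
    then show ?thesis
      using y by (intro bexI[of _ a]) (auto simp: smult_image_def annihilator_mem_iff intro!: bexI[of _ y])
  qed
  obtain S where S: "finite S" "S \<subseteq> carrier M" and span: "module_span R M S = carrier M"
    using fg unfolding finitely_generated_def by blast
  have "\<exists>a\<in>carrier R - annihilator R M. \<forall>y\<in>S. a \<odot>\<^bsub>M\<^esub> y \<in> ?X"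
    using S
  proof (induction S rule: finite_induct)
    case empty
    then show ?case using one by blast
  next
    case (insert y S)
    then obtain a where a: "a \<in> carrier R - annihilator R M" "\<forall>y\<in>S. a \<odot>\<^bsub>M\<^esub> y \<in> ?X" by auto
    obtain b where b: "b \<in> carrier R - annihilator R M" "b \<odot>\<^bsub>M\<^esub> y \<in> ?X"
      using single[of y] insert.prems by auto
    have "a \<otimes> b \<in> carrier R - annihilator R M"
      using a b p.I_prime by auto
    moreover have "(a \<otimes> b) \<odot>\<^bsub>M\<^esub> y \<in> ?X"
      using a b insert.prems submoduleE(4)[OF X] by (simp add: smult_assoc1)
    moreover have "(a \<otimes> b) \<odot>\<^bsub>M\<^esub> z \<in> ?X" if "z \<in> S" for z
    proof -
      have "(a \<otimes> b) \<odot>\<^bsub>M\<^esub> z = b \<odot>\<^bsub>M\<^esub> (a \<odot>\<^bsub>M\<^esub> z)"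
        using that a b insert.prems by (subst smult_left_commute) (auto simp: smult_assoc1)
      then show ?thesis using that a b submoduleE(4)[OF X] by simp
    qed
    ultimately show ?case by blast
  qed
  then obtain a where a: "a \<in> carrier R - annihilator R M" "\<forall>y\<in>S. a \<odot>\<^bsub>M\<^esub> y \<in> ?X" by blast
  \<comment> \<open>The elements that \<open>a\<close> carries into \<open>Rx\<close> form a
    submodule containing the generators.\<close>
  have "submodule {m \<in> carrier M. a \<odot>\<^bsub>M\<^esub> m \<in> ?X} R M"
    using submodule_smult_vimage[OF X] a by blast
  then have "module_span R M S \<subseteq> {m \<in> carrier M. a \<odot>\<^bsub>M\<^esub> m \<in> ?X}"
    using a S unfolding module_span_def by blast
  then show thesis
    using span by (intro that[OF a(1)]) (auto simp: smult_image_def)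
qed

text \<open>Multiplication by \<open>a\<close> embeds \<open>M\<close> into \<open>Rx\<close>, and
  by torsion-freeness \<open>Rx\<close> is a copy of \<open>R\<close> modulo the
  annihilator.\<close>

lemma (in module) univalent_imp_isomorphic_ideal:
  assumes noeth: "noetherian_ring R" and fg: "finitely_generated R M"
    and len: "has_olen R M (omega_pow d)"
  shows "\<exists>J. ideal J (R Quot annihilator R M) \<and>
    module_isomorphic R M (quot_ideal_module R (annihilator R M) J)"
proof -
  let ?p = "annihilator R M"
  interpret p: primeideal ?p R
    using univalent_annihilator(1)[OF noeth len] .
  interpret Q: cring "R Quot ?p"
    using p.quotient_is_cring[OF R.is_cring] .
  obtain x where x: "x \<in> carrier M" "x \<noteq> \<zero>\<^bsub>M\<^esub>"
    using univalent_nonzero[OF len] M.zero_closed by blast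
  obtain a where a: "a \<in> carrier R" "a \<notin> ?p"
    and ax: "\<And>m. m \<in> carrier M \<Longrightarrow> \<exists>r\<in>carrier R. a \<odot>\<^bsub>M\<^esub> m = r \<odot>\<^bsub>M\<^esub> x"
    by (rule univalent_embedding[OF noeth fg len x]) blast
  \<comment> \<open>All coefficients \<open>r\<close> with \<open>a m = r x\<close> form one coset
    of the annihilator, so no choice of \<open>r\<close> enters the map.\<close>
  define f where "f m = {r \<in> carrier R. a \<odot>\<^bsub>M\<^esub> m = r \<odot>\<^bsub>M\<^esub> x}" for m
  have f_eq: "f m = ?p +> r" if r: "r \<in> carrier R" "a \<odot>\<^bsub>M\<^esub> m = r \<odot>\<^bsub>M\<^esub> x" for m r
  proof -
    have mem: "s \<odot>\<^bsub>M\<^esub> x = r \<odot>\<^bsub>M\<^esub> x \<longleftrightarrow> s \<in> ?p +> r" if s: "s \<in> carrier R" for s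
    proof -
      have "s \<odot>\<^bsub>M\<^esub> x = r \<odot>\<^bsub>M\<^esub> x \<longleftrightarrow> (s \<ominus> r) \<odot>\<^bsub>M\<^esub> x = \<zero>\<^bsub>M\<^esub>"
        using s r(1) x(1) by (simp add: smult_minus_distr M.minus_eq_zero_iff)
      then show ?thesis
        using univalent_annihilator(2)[OF noeth len _ x, of "s \<ominus> r"] s r(1) x(1)
        by (auto simp: annihilator_mem_iff p.mem_coset_iff)
    qed
    have "?p +> r \<subseteq> carrier R"
      using R.a_r_coset_subset_G[OF p.a_subset r(1)] .
    then have "s \<in> f m \<longleftrightarrow> s \<in> ?p +> r" for s
      using mem[of s] by (auto simp: f_def r(2))
    then show ?thesis by blast
  qed
  have f_add: "f (m \<oplus>\<^bsub>M\<^esub> n) = f m \<oplus>\<^bsub>R Quot ?p\<^esub> f n" if mn: "m \<in> carrier M" "n \<in> carrier M" for m n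
  proof -
    obtain r s where rs: "r \<in> carrier R" "a \<odot>\<^bsub>M\<^esub> m = r \<odot>\<^bsub>M\<^esub> x" "s \<in> carrier R" "a \<odot>\<^bsub>M\<^esub> n = s \<odot>\<^bsub>M\<^esub> x"
      using ax mn by meson
    have "a \<odot>\<^bsub>M\<^esub> (m \<oplus>\<^bsub>M\<^esub> n) = (r \<oplus> s) \<odot>\<^bsub>M\<^esub> x"
      using rs mn a x(1) by (simp add: smult_r_distr smult_l_distr)
    then have "f (m \<oplus>\<^bsub>M\<^esub> n) = ?p +> (r \<oplus> s)"
      using rs by (intro f_eq) auto
    then show ?thesis using f_eq rs by (simp add: p.FactRing_ops)
  qed
  have f_smult: "f (t \<odot>\<^bsub>M\<^esub> m) = (?p +> t) \<otimes>\<^bsub>R Quot ?p\<^esub> f m" if tm: "t \<in> carrier R" "m \<in> carrier M" for t m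
  proof -
    obtain r where r: "r \<in> carrier R" "a \<odot>\<^bsub>M\<^esub> m = r \<odot>\<^bsub>M\<^esub> x"
      using ax tm by meson
    have "a \<odot>\<^bsub>M\<^esub> (t \<odot>\<^bsub>M\<^esub> m) = (t \<otimes> r) \<odot>\<^bsub>M\<^esub> x"
      using r tm a x(1) by (simp add: smult_assoc1 smult_left_commute[of a])
    then have "f (t \<odot>\<^bsub>M\<^esub> m) = ?p +> (t \<otimes> r)"
      using r tm by (intro f_eq) auto
    then show ?thesis using f_eq r tm by (simp add: p.FactRing_ops)
  qed
  have inj: "inj_on f (carrier M)"
  proof (rule inj_onI)
    fix m n assume mn: "m \<in> carrier M" "n \<in> carrier M" "f m = f n"
    obtain r where r: "r \<in> carrier R" "a \<odot>\<^bsub>M\<^esub> m = r \<odot>\<^bsub>M\<^esub> x" using ax mn by meson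
    then have "r \<in> f n" using mn(3) unfolding f_def by blast
    then have "a \<odot>\<^bsub>M\<^esub> (m \<ominus>\<^bsub>M\<^esub> n) = \<zero>\<^bsub>M\<^esub>"
      using r mn a x(1) by (simp add: f_def smult_minus_distr2 M.minus_eq_zero_iff)
    then have "m \<ominus>\<^bsub>M\<^esub> n = \<zero>\<^bsub>M\<^esub>"
      using univalent_annihilator(2)[OF noeth len a(1)] a(2) mn M.minus_closed by blast
    then show "m = n" using mn by (simp add: M.minus_eq_zero_iff)
  qed
  have "ideal (f ` carrier M) (R Quot ?p)"
  proof (rule Q.idealI_closed)
    show sub: "f ` carrier M \<subseteq> carrier (R Quot ?p)"
      using ax f_eq unfolding p.FactRing_ops(1) by blast
    have "f \<zero>\<^bsub>M\<^esub> = ?p +> \<zero>"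
      using a x(1) by (intro f_eq) auto
    then show "\<zero>\<^bsub>R Quot ?p\<^esub> \<in> f ` carrier M"
      using p.a_subset by (auto simp: p.FactRing_ops(2) intro!: image_eqI[of _ _ "\<zero>\<^bsub>M\<^esub>"])
    show "A \<oplus>\<^bsub>R Quot ?p\<^esub> B \<in> f ` carrier M" if "A \<in> f ` carrier M" "B \<in> f ` carrier M" for A B
      using that by (auto simp: f_add[symmetric])
    show "A \<otimes>\<^bsub>R Quot ?p\<^esub> B \<in> f ` carrier M" if "A \<in> carrier (R Quot ?p)" "B \<in> f ` carrier M" for A B
      using that unfolding p.FactRing_ops(1) by (auto simp: f_smult[symmetric])
  qed
  moreover have "module_isomorphic R M (quot_ideal_module R ?p (f ` carrier M))"
    unfolding module_isomorphic_def quot_ideal_module_simps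
    using inj f_add f_smult by (intro exI[of _ f]) (simp add: bij_betw_def)
  ultimately show ?thesis by blast
qed

text \<open>The exponent is \<open>d = dim (R/p)\<close>. Nonzero submodules correspond to nonzero
  ideals of \<open>R/p\<close>, which gives the upper bound; a nonzero \<open>y\<close> has
  annihilator \<open>p\<close>, so \<open>Ry\<close> is a copy of \<open>R/p\<close> and contains a
  chain of type \<open>\<omega>\<^sup>d\<close>.\<close>

lemma (in module) isomorphic_ideal_imp_univalent:
  assumes noeth: "noetherian_ring R" and dim: "finite_krull_dim R"
    and prime: "primeideal p R" and ann: "annihilator R M = p"
    and J: "ideal J (R Quot p)" and iso: "module_isomorphic R M (quot_ideal_module R p J)"
  shows "univalent R M"
proof -
  interpret p: primeideal p R by fact
  obtain f where bij: "bij_betw f (carrier M) J"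
    and f_add: "\<And>m n. \<lbrakk>m \<in> carrier M; n \<in> carrier M\<rbrakk> \<Longrightarrow> f (m \<oplus>\<^bsub>M\<^esub> n) = f m \<oplus>\<^bsub>R Quot p\<^esub> f n"
    and f_smult: "\<And>r m. \<lbrakk>r \<in> carrier R; m \<in> carrier M\<rbrakk> \<Longrightarrow> f (r \<odot>\<^bsub>M\<^esub> m) = (p +> r) \<otimes>\<^bsub>R Quot p\<^esub> f m"
    using iso unfolding module_isomorphic_def quot_ideal_module_simps by blast
  have rep: "\<exists>c\<in>carrier R. f m = p +> c" if "m \<in> carrier M" for m
    using bij that ideal.Icarr[OF J, of "f m"] unfolding p.FactRing_ops(1) bij_betw_def by blast
  have f_inj: "m = n" if "m \<in> carrier M" "n \<in> carrier M" "f m = f n" for m n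
    using bij that unfolding bij_betw_def inj_on_def by blast
  have f_zero: "f \<zero>\<^bsub>M\<^esub> = p"
  proof -
    obtain c where c: "c \<in> carrier R" "f \<zero>\<^bsub>M\<^esub> = p +> c" using rep M.zero_closed by blast
    have "f \<zero>\<^bsub>M\<^esub> = (p +> \<zero>) \<otimes>\<^bsub>R Quot p\<^esub> f \<zero>\<^bsub>M\<^esub>"
      using f_smult[of \<zero> "\<zero>\<^bsub>M\<^esub>"] by simp
    also have "\<dots> = (p +> \<zero>) \<otimes>\<^bsub>R Quot p\<^esub> (p +> c)" by (simp only: c(2))
    also have "\<dots> = p +> \<zero>" using c(1) p.FactRing_ops(4)[of \<zero> c] by simp
    finally show ?thesis using p.coset_eq_self_iff[of \<zero>] by simp
  qed
  \<comment> \<open>The preimage in \<open>R\<close> of the ideal of \<open>R/p\<close> that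
    corresponds to \<open>N\<close>.\<close>
  define I where "I N = {r \<in> carrier R. p +> r \<in> f ` N}" for N
  have ideal_I: "ideal (I N) R" and p_sub: "p \<subseteq> I N" if N: "submodule N R M" for N
  proof -
    note sub = subsetD[OF submoduleE(1)[OF N]]
    show pI: "p \<subseteq> I N"
    proof
      fix r assume r: "r \<in> p"
      then have "p +> r = f \<zero>\<^bsub>M\<^esub>" using p.coset_eq_self_iff p.Icarr f_zero by auto
      then show "r \<in> I N" using r p.Icarr submodule_zero[OF N] by (auto simp: I_def)
    qed
    show "ideal (I N) R"
    proof (rule R.idealI_closed)
      show "I N \<subseteq> carrier R" by (auto simp: I_def)
      show "\<zero> \<in> I N" using pI p.zero_closed by blast
      show "r \<oplus> s \<in> I N" if rs: "r \<in> I N" "s \<in> I N" for r s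
      proof -
        obtain m n where mn: "m \<in> N" "p +> r = f m" "n \<in> N" "p +> s = f n"
          using rs unfolding I_def by blast
        have c: "r \<in> carrier R" "s \<in> carrier R" using rs by (auto simp: I_def)
        have "p +> (r \<oplus> s) = f (m \<oplus>\<^bsub>M\<^esub> n)"
          using p.FactRing_ops(3)[OF c] mn sub f_add by simp
        then show ?thesis using c mn submoduleE(5)[OF N] by (simp add: I_def)
      qed
      show "r \<otimes> s \<in> I N" if rs: "r \<in> carrier R" "s \<in> I N" for r s
      proof -
        obtain n where n: "n \<in> N" "p +> s = f n"
          using rs unfolding I_def by blast
        have c: "s \<in> carrier R" using rs by (auto simp: I_def)
        have "p +> (r \<otimes> s) = f (r \<odot>\<^bsub>M\<^esub> n)"
          using p.FactRing_ops(4)[OF rs(1) c] n sub f_smult rs(1) by simp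
        then show ?thesis using c rs(1) n submoduleE(4)[OF N] by (simp add: I_def)
      qed
    qed
  qed
  have I_strict: "I A \<subset> I B" if A: "submodule A R M" and B: "submodule B R M" and "A \<subset> B" for A B
  proof -
    obtain b where b: "b \<in> B" "b \<notin> A" using \<open>A \<subset> B\<close> by blast
    have bM: "b \<in> carrier M" using b submoduleE(1)[OF B] by blast
    obtain c where c: "c \<in> carrier R" "f b = p +> c" using rep[OF bM] by blast
    have "c \<notin> I A"
      using f_inj[OF bM] b(2) submoduleE(1)[OF A] by (auto simp: I_def c(2)[symmetric])
    moreover have "c \<in> I B" using b c by (auto simp: I_def)
    ultimately show ?thesis using \<open>A \<subset> B\<close> unfolding I_def by blast
  qed
  obtain d where chain: "prime_chain_above R d p" and no_chain: "\<not> prime_chain_above R (Suc d) p"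
    using finite_krull_dim_bound[OF dim prime] .
  have graded: "omega_graded d (nonzero_submodules R M)"
  proof (rule omega_graded_le[OF R.omega_graded_ideals[OF noeth prime no_chain], where g = I])
    fix A assume "A \<in> nonzero_submodules R M"
    then have A: "submodule A R M" "{\<zero>\<^bsub>M\<^esub>} \<subset> A"
      using submodule_zero by (auto simp: nonzero_submodules_def)
    then have "I {\<zero>\<^bsub>M\<^esub>} \<subset> I A" using I_strict submodule_singleton_zero by blast
    then show "I A \<in> {I. ideal I R \<and> p \<subset> I}"
      using ideal_I[OF A(1)] p_sub[OF submodule_singleton_zero] by blast
  next
    fix A B assume "A \<in> nonzero_submodules R M" "B \<in> nonzero_submodules R M" "A \<subset> B"
    then show "I A \<subset> I B" using I_strict by (simp add: nonzero_submodules_def)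
  qed
  \<comment> \<open>The case \<open>J = 0\<close> is excluded by the annihilator:
    \<open>\<one>\<close> kills the zero module but lies outside \<open>p\<close>.\<close>
  have "\<exists>y\<in>carrier M. y \<noteq> \<zero>\<^bsub>M\<^esub>"
  proof (rule ccontr)
    assume "\<not> ?thesis"
    then have "\<one> \<in> p" unfolding ann[symmetric] annihilator_def by auto
    then show False using p.one_imp_carrier p.I_notcarr by blast
  qed
  then obtain y where y: "y \<in> carrier M" "y \<noteq> \<zero>\<^bsub>M\<^esub>" by blast
  \<comment> \<open>\<open>f y\<close> is a nonzero element of the domain \<open>R/p\<close>, so
    only \<open>p\<close> annihilates it.\<close>
  have "r \<in> p" if r: "r \<in> carrier R" "r \<odot>\<^bsub>M\<^esub> y = \<zero>\<^bsub>M\<^esub>" for r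
  proof -
    obtain c where c: "c \<in> carrier R" "f y = p +> c" using rep[OF y(1)] by blast
    have "c \<notin> p"
      using f_inj[OF y(1) M.zero_closed] y(2) c f_zero p.coset_eq_self_iff by auto
    have "p +> (r \<otimes> c) = f (r \<odot>\<^bsub>M\<^esub> y)"
      using p.FactRing_ops(4)[OF r(1) c(1)] f_smult[OF r(1) y(1)] c(2) by simp
    then have "r \<otimes> c \<in> p" using f_zero r c(1) p.coset_eq_self_iff by auto
    then show "r \<in> p" using p.I_prime[OF r(1) c(1)] \<open>c \<notin> p\<close> by blast
  qed
  then have colon_y: "colon R M {\<zero>\<^bsub>M\<^esub>} y = p"
    using y ann by (auto simp: colon_def annihilator_def)
  obtain G where G: "\<And>xs. length xs = d \<Longrightarrow> submodule (G xs) R M \<and> {\<zero>\<^bsub>M\<^esub>} \<subset> G xs"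
    and anti: "\<And>xs ys. \<lbrakk>length xs = d; length ys = d; lexless xs ys\<rbrakk> \<Longrightarrow> G ys \<subset> G xs"
    by (rule ex_descending_submodules[OF submodule_singleton_zero y(1)])
      (use prime chain colon_y in auto)
  let ?C = "G ` {xs. length xs = d}"
  have "G xs \<in> nonzero_submodules R M" if "length xs = d" for xs
    using G[OF that] by (simp add: nonzero_submodules_def psubset_eq eq_commute)
  then have C: "?C \<subseteq> nonzero_submodules R M"
    by (simp add: image_subset_iff)
  have chain_C: "chain\<^sub>\<subseteq> ?C"
    using chain_subset_antitone_range anti .
  have "rev_incl ?C \<le>o omega_pow d"
    using omega_graded_chain[OF graded C chain_C] .
  \<comment> \<open>The supremum is attained: \<open>G\<close> maps the tuples strictly
    monotonically into this one chain, so every upper bound is at least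
    \<open>\<omega>\<^sup>d\<close>.\<close>
  then have "omega_pow d \<le>o rev_incl ?C"
    using anti ordLeq_Well_order_simp[of "rev_incl ?C"] Well_order_omega_pow[of d]
    by (intro strict_mono_imp_ordLeq[where f = G])
      (auto simp: Field_rev_incl Field_omega_pow omega_pow_minus_Id rev_incl_minus_Id)
  then have "omega_pow d \<le>o t" if "rev_incl ?C \<le>o t" for t :: "nat list rel"
    using that ordLeq_transitive by blast
  moreover have "rev_incl ?C \<in> {rev_incl C |C. C \<subseteq> nonzero_submodules R M \<and> chain\<^sub>\<subseteq> C}"
    using C chain_C by blast
  moreover have "\<forall>s\<in>{rev_incl C |C. C \<subseteq> nonzero_submodules R M \<and> chain\<^sub>\<subseteq> C}. s \<le>o omega_pow d"
    using omega_graded_chain[OF graded] by auto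
  ultimately have "has_olen R M (omega_pow d)"
    unfolding has_olen_def is_osup_def using Well_order_omega_pow by simp
  then show ?thesis unfolding univalent_def by blast
qed

theorem theorem5p1:
  fixes R :: "('a, 'm) ring_scheme" and M :: "('a, 'b, 'n) module_scheme"
  assumes "cring R" and "noetherian_ring R" and "finite_krull_dim R"
    and "module R M" and "finitely_generated R M"
  shows "univalent R M \<longleftrightarrow>
    (\<exists>p. primeideal p R \<and> annihilator R M = p \<and>
         (\<exists>J. ideal J (R Quot p) \<and> module_isomorphic R M (quot_ideal_module R p J)))"
proof
  assume "univalent R M"
  then obtain d where len: "has_olen R M (omega_pow d)" unfolding univalent_def ..
  show "\<exists>p. primeideal p R \<and> annihilator R M = p \<and>
         (\<exists>J. ideal J (R Quot p) \<and> module_isomorphic R M (quot_ideal_module R p J))"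
    using module.univalent_annihilator(1)[OF assms(4,2) len]
      module.univalent_imp_isomorphic_ideal[OF assms(4,2,5) len] by blast
next
  assume "\<exists>p. primeideal p R \<and> annihilator R M = p \<and>
         (\<exists>J. ideal J (R Quot p) \<and> module_isomorphic R M (quot_ideal_module R p J))"
  then show "univalent R M"
    using module.isomorphic_ideal_imp_univalent[OF assms(4,2,3)] by blast
qed

end
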